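(* Let $d\geq 3$. Then for every $\lambda\in\mathbb{C}$ the Laurent polynomial $z\mapsto\mathcal{P}(z,\lambda)$ is irreducible, i.e. there are no Laurent polynomials $f,g$ in $z=(z_1,\dots,z_d)$, neither of which is a monomial, such that $\mathcal{P}(\cdot,\lambda)=fg$.
   Context: Fix positive integers $q_1,\dots,q_d$ with greatest common divisor $1$, $Q=q_1\cdots q_d$, $\Gamma=q_1\mathbb{Z}\oplus\cdots\oplus q_d\mathbb{Z}$, and a $\Gamma$-periodic $V:\mathbb{Z}^d\to\mathbb{C}$. The discrete Laplacian is $(\Delta u)(n)=\sum_{\|n'-n\|_1=1}u(n')$. Let $W=\{n\in\mathbb{Z}^d:0\le n_j\le q_j-1\ \forall j\}$. For $z\in(\mathbb{C}\setminus\{0\})^d$, the space of functions $u:\mathbb{Z}^d\to\mathbb{C}$ with $u(n+q_je_j)=z_ju(n)$ for all $j,n$ is identified with $\mathbb{C}^W$ by restriction to $W$; $\mathcal{D}(z)$ denotes the $Q\times Q$ matrix of $-\Delta+V$ acting on this space. Set $\mathcal{P}(z,\lambda)=\det(\mathcal{D}(z)-\lambda I)$; it is a Laurent polynomial in $z_1,\dots,z_d$ and a polynomial in $\lambda$. A monomial is a Laurent polynomial of the form $Cz_1^{a_1}\cdots z_d^{a_d}$ with $C\neq 0$ constant and $a_j\in\mathbb{Z}$. *)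

theory Defs
  imports Complex_Main "HOL-Library.Poly_Mapping" "HOL-Combinatorics.Permutations"
begin

(* Dimension d = CARD('d) for a finite index type 'd.  Lattice points n are
functions 'd \<Rightarrow> int.  A Laurent polynomial in z_j (j :: 'd) with complex
coefficients is a finitely supported map from exponent vectors ('d \<Rightarrow>\<^sub>0 int)
to complex numbers; multiplication is convolution (Poly_Mapping). *)

type_synonym 'd laurent = "('d \<Rightarrow>\<^sub>0 int) \<Rightarrow>\<^sub>0 complex"

definition fund_domain :: "('d \<Rightarrow> nat) \<Rightarrow> ('d \<Rightarrow> int) set" where
  "fund_domain q = {n. \<forall>j. 0 \<le> n j \<and> n j < int (q j)}"

(* Reduction of a lattice point n into W, and the exponent vector k with
n = red n + (q_j k_j)_j, so that u(n) = z^k u(red n) for Floquet functions u. *)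
definition red_pt :: "('d \<Rightarrow> nat) \<Rightarrow> ('d \<Rightarrow> int) \<Rightarrow> ('d \<Rightarrow> int)" where
  "red_pt q n = (\<lambda>j. n j mod int (q j))"

definition quot_pt :: "('d::finite \<Rightarrow> nat) \<Rightarrow> ('d \<Rightarrow> int) \<Rightarrow> ('d \<Rightarrow>\<^sub>0 int)" where
  "quot_pt q n = Abs_poly_mapping (\<lambda>j. n j div int (q j))"

definition laurent_const :: "complex \<Rightarrow> 'd laurent" where
  "laurent_const c = Poly_Mapping.single 0 c"

definition is_monomial :: "'d laurent \<Rightarrow> bool" where
  "is_monomial f \<longleftrightarrow> (\<exists>a c. c \<noteq> 0 \<and> f = Poly_Mapping.single a c)"

(* Entry (m,w) of D(z) - \<lambda> I as a Laurent polynomial in z: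
((-\<Delta> + V - \<lambda>) u)(m) = - \<Sum>_{|n'-m|_1 = 1} z^{quot n'} u(red n') + (V m - lam) u(m). *)
definition floquet_entry ::
  "('d::finite \<Rightarrow> nat) \<Rightarrow> (('d \<Rightarrow> int) \<Rightarrow> complex) \<Rightarrow> complex \<Rightarrow> ('d \<Rightarrow> int) \<Rightarrow> ('d \<Rightarrow> int) \<Rightarrow> 'd laurent"
where
  "floquet_entry q V lam m w =
     (if m = w then laurent_const (V m - lam) else 0)
     - (\<Sum>n'\<in>{n'. (\<Sum>j\<in>UNIV. \<bar>n' j - m j\<bar>) = 1}.
          if red_pt q n' = w then Poly_Mapping.single (quot_pt q n') 1 else 0)"

definition det_on :: "'a set \<Rightarrow> ('a \<Rightarrow> 'a \<Rightarrow> 'r::comm_ring_1) \<Rightarrow> 'r" where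
  "det_on W M = (\<Sum>p\<in>{p. p permutes W}. of_int (sign p) * (\<Prod>m\<in>W. M m (p m)))"

definition floquet_poly ::
  "('d::finite \<Rightarrow> nat) \<Rightarrow> (('d \<Rightarrow> int) \<Rightarrow> complex) \<Rightarrow> complex \<Rightarrow> 'd laurent" where
  "floquet_poly q V lam = det_on (fund_domain q) (floquet_entry q V lam)"

end

theory Submission
  imports Defs "HOL-Computational_Algebra.Fundamental_Theorem_Algebra" "Jordan_Normal_Form.Determinant"
begin

text \<open>
  Substitute \<open>z\<^sub>j = x\<^sub>j ^ q\<^sub>j\<close>. For a weight \<open>w \<in> {-1,0,1}\<^sup>d\<close>, the leading part of \<open>P\<close> under
  \<open>x\<^sub>j \<mapsto> t ^ w\<^sub>j x\<^sub>j\<close>, \<open>t \<rightarrow> \<infinity>\<close>, is the determinant of a sum of shifts: the potential and the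
  spectral parameter disappear, and the discrete Fourier transform diagonalises it as a product of
  \<open>Q\<close> linear forms in the \<open>x\<^sub>j ^ w\<^sub>j\<close>. For sign vectors \<open>w\<close> the roots of unity permute these forms
  transitively, and they are pairwise non-proportional because the gcd of the \<open>q\<^sub>j\<close> is 1. So each
  such facet polynomial is irreducible in \<open>z\<close>, and for a factorization \<open>P = f g\<close> the part of
  \<open>f\<close> or of \<open>g\<close> on that facet is a monomial.

  The Newton polytope of \<open>P\<close> is a cross-polytope with vertices \<open>\<plusminus>(Q/q\<^sub>i) e\<^sub>i\<close>; write each vertex as
  \<open>\<alpha> + \<beta>\<close> with \<open>\<alpha>\<close>, \<open>\<beta>\<close> exponents of \<open>f\<close>, \<open>g\<close>. On each facet either all \<open>\<alpha>\<close> or all \<open>\<beta>\<close> agree.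
  For \<open>d \<ge> 3\<close> adjacent facets share two vertices, so the same alternative holds on both.
  Hence, say, all \<open>\<beta>\<close> agree, and \<open>g\<close> is a monomial.
\<close>

subsection \<open>Laurent polynomials as functions on the torus\<close>

definition torus :: "('d \<Rightarrow> complex) set" where
  "torus = {y. \<forall>j. y j \<noteq> 0}"

definition coord_powi :: "('d \<Rightarrow> int) \<Rightarrow> ('d \<Rightarrow> complex) \<Rightarrow> 'd \<Rightarrow> complex" where
  "coord_powi e y = (\<lambda>j. y j powi e j)"

definition mono_eval :: "('d::finite \<Rightarrow>\<^sub>0 int) \<Rightarrow> ('d \<Rightarrow> complex) \<Rightarrow> complex" where
  "mono_eval a y = (\<Prod>j\<in>UNIV. y j powi Poly_Mapping.lookup a j)"

definition sum_eval ::
  "('d::finite \<Rightarrow>\<^sub>0 int) set \<Rightarrow> (('d \<Rightarrow>\<^sub>0 int) \<Rightarrow> complex) \<Rightarrow> ('d \<Rightarrow> complex) \<Rightarrow> complex" where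
  "sum_eval A c y = (\<Sum>a\<in>A. c a * mono_eval a y)"

definition laurent_eval :: "'d::finite laurent \<Rightarrow> ('d \<Rightarrow> complex) \<Rightarrow> complex" where
  "laurent_eval f y = sum_eval (Poly_Mapping.keys f) (Poly_Mapping.lookup f) y"

definition weight :: "('d::finite \<Rightarrow> int) \<Rightarrow> ('d \<Rightarrow>\<^sub>0 int) \<Rightarrow> int" where
  "weight v a = (\<Sum>j\<in>UNIV. v j * Poly_Mapping.lookup a j)"

lemma coord_powi_torus: "y \<in> torus \<Longrightarrow> coord_powi e y \<in> torus"
  by (simp add: torus_def coord_powi_def)

lemma mono_eval_nonzero: "y \<in> torus \<Longrightarrow> mono_eval a y \<noteq> 0"
  by (simp add: torus_def mono_eval_def)

lemma mono_eval_zero [simp]: "mono_eval 0 y = 1"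
  by (simp add: mono_eval_def)

lemma mono_eval_add: "y \<in> torus \<Longrightarrow> mono_eval (a + b) y = mono_eval a y * mono_eval b y"
  by (simp add: torus_def mono_eval_def lookup_add power_int_add prod.distrib)

lemma mono_eval_mult: "mono_eval a (\<lambda>j. y j * z j) = mono_eval a y * mono_eval a z"
  by (simp add: mono_eval_def power_int_mult_distrib prod.distrib)

lemma mono_eval_single:
  "mono_eval (Poly_Mapping.single i k) y = y i powi k"
proof -
  have "mono_eval (Poly_Mapping.single i k) y = (\<Prod>j\<in>UNIV. if j = i then y i powi k else 1)"
    unfolding mono_eval_def by (intro prod.cong) (auto simp: lookup_single when_def)
  then show ?thesis by simp
qed

lemma mono_eval_scale:
  assumes "t \<noteq> 0"
  shows "mono_eval a (\<lambda>j. z j * t powi v j) = mono_eval a z * t powi weight v a"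
proof -
  have "(\<Prod>j\<in>J. (t powi v j) powi Poly_Mapping.lookup a j)
      = t powi (\<Sum>j\<in>J. v j * Poly_Mapping.lookup a j)" if "finite J" for J
    using that by induction (auto simp: power_int_add assms power_int_mult)
  then show ?thesis
    unfolding mono_eval_mult by (simp add: mono_eval_def weight_def)
qed

lemma sum_eval_extend:
  assumes "finite B" "A \<subseteq> B" "\<And>a. a \<in> B - A \<Longrightarrow> c a = 0"
  shows "sum_eval A c y = sum_eval B c y"
  unfolding sum_eval_def using assms by (intro sum.mono_neutral_left) auto

lemma laurent_eval_superset:
  assumes "finite B" "Poly_Mapping.keys f \<subseteq> B"
  shows "laurent_eval f y = sum_eval B (Poly_Mapping.lookup f) y"
  unfolding laurent_eval_def
  by (rule sum_eval_extend) (use assms in \<open>auto simp: in_keys_iff\<close>)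

lemma laurent_eval_zero [simp]: "laurent_eval 0 y = 0"
  by (simp add: laurent_eval_def sum_eval_def)

lemma laurent_eval_single: "laurent_eval (Poly_Mapping.single a c) y = c * mono_eval a y"
  by (subst laurent_eval_superset[of "{a}"]) (auto simp: sum_eval_def)

lemma laurent_eval_one [simp]: "laurent_eval 1 y = 1"
  by (metis laurent_eval_single mono_eval_zero mult_1 single_one)

lemma laurent_eval_add: "laurent_eval (f + g) y = laurent_eval f y + laurent_eval g y"
proof -
  let ?B = "Poly_Mapping.keys f \<union> Poly_Mapping.keys g"
  have "laurent_eval (f + g) y = sum_eval ?B (Poly_Mapping.lookup (f + g)) y"
    by (rule laurent_eval_superset) (use Poly_Mapping.keys_add[of f g] in auto)
  also have "\<dots> = sum_eval ?B (Poly_Mapping.lookup f) y + sum_eval ?B (Poly_Mapping.lookup g) y"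
    by (simp add: sum_eval_def lookup_add sum.distrib algebra_simps)
  also have "\<dots> = laurent_eval f y + laurent_eval g y"
    by (simp add: laurent_eval_superset[of ?B])
  finally show ?thesis .
qed

lemma laurent_eval_uminus: "laurent_eval (- f) y = - laurent_eval f y"
  using laurent_eval_add[of f "- f" y] by (simp add: eq_neg_iff_add_eq_0 add.commute)

lemma laurent_eval_diff: "laurent_eval (f - g) y = laurent_eval f y - laurent_eval g y"
  using laurent_eval_add[of f "- g" y] by (simp add: laurent_eval_uminus)

lemma laurent_eval_sum: "laurent_eval (sum F I) y = (\<Sum>i\<in>I. laurent_eval (F i) y)"
  by (induction I rule: infinite_finite_induct) (auto simp: laurent_eval_add)

lemma laurent_sum_singles:
  fixes f :: "'d laurent"
  shows "f = (\<Sum>a\<in>Poly_Mapping.keys f. Poly_Mapping.single a (Poly_Mapping.lookup f a))"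
  by (rule poly_mapping_eqI)
     (auto simp: lookup_sum lookup_single when_def in_keys_iff sum.delta' intro: sum.neutral)

lemma laurent_eval_mult:
  assumes "y \<in> torus"
  shows "laurent_eval (f * g) y = laurent_eval f y * laurent_eval g y"
proof -
  let ?m = "\<lambda>f a. Poly_Mapping.single a (Poly_Mapping.lookup f a)"
  have "f * g = (\<Sum>a\<in>Poly_Mapping.keys f. ?m f a) * (\<Sum>b\<in>Poly_Mapping.keys g. ?m g b)"
    by (rule arg_cong2[OF laurent_sum_singles laurent_sum_singles])
  also have "\<dots> = (\<Sum>a\<in>Poly_Mapping.keys f. \<Sum>b\<in>Poly_Mapping.keys g. ?m f a * ?m g b)"
    by (rule sum_product)
  finally have "laurent_eval (f * g) y =
      (\<Sum>a\<in>Poly_Mapping.keys f. \<Sum>b\<in>Poly_Mapping.keys g. laurent_eval (?m f a * ?m g b) y)"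
    by (simp only: laurent_eval_sum)
  also have "\<dots> = laurent_eval f y * laurent_eval g y"
    by (simp add: mult_single laurent_eval_single mono_eval_add[OF assms] sum_product mult_ac
        laurent_eval_def[of f] laurent_eval_def[of g] sum_eval_def)
  finally show ?thesis .
qed

lemma laurent_eval_prod:
  assumes "y \<in> torus"
  shows "laurent_eval (prod F I) y = (\<Prod>i\<in>I. laurent_eval (F i) y)"
  by (induction I rule: infinite_finite_induct) (auto simp: laurent_eval_mult[OF assms])

lemma laurent_eval_of_int: "laurent_eval (of_int k) y = of_int k"
proof -
  have nat: "laurent_eval (of_nat n) y = of_nat n" for n
    by (induction n) (auto simp: laurent_eval_add)
  show ?thesis
    by (cases k) (auto simp: nat laurent_eval_diff laurent_eval_uminus simp del: of_nat_Suc)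
qed

text \<open>Artin's argument: comparing a relation at \<open>y\<close> and at \<open>y \<cdot> z\<close> eliminates one character.\<close>

lemma mono_eval_lin_indep:
  assumes "finite A" and e: "\<And>j. e j \<noteq> 0"
    and "\<And>y. y \<in> torus \<Longrightarrow> sum_eval A c (coord_powi e y) = 0"
  shows "\<forall>a\<in>A. c a = 0"
  using assms(1,3)
proof (induction A arbitrary: c)
  case empty
  then show ?case by simp
next
  case (insert a A)
  let ?\<chi> = "\<lambda>a y. mono_eval a (coord_powi e y)"
  have rel: "c a * ?\<chi> a y + (\<Sum>b\<in>A. c b * ?\<chi> b y) = 0" if "y \<in> torus" for y
    using insert.prems[OF that] insert.hyps by (simp add: sum_eval_def)
  have mult: "?\<chi> b (\<lambda>j. y j * z j) = ?\<chi> b y * ?\<chi> b z" for b y z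
    by (simp add: coord_powi_def power_int_mult_distrib mono_eval_mult)
  have "c b * (?\<chi> b z - ?\<chi> a z) = 0" if b: "b \<in> A" and z: "z \<in> torus" for b z
  proof -
    have "\<forall>b\<in>A. c b * (?\<chi> b z - ?\<chi> a z) = 0"
    proof (rule insert.IH)
      fix y :: "'a \<Rightarrow> complex"
      assume y: "y \<in> torus"
      have yz: "(\<lambda>j. y j * z j) \<in> torus" using y z by (simp add: torus_def)
      have r1: "c a * ?\<chi> a y * ?\<chi> a z + (\<Sum>b\<in>A. c b * ?\<chi> b y * ?\<chi> b z) = 0"
        using rel[OF yz] by (simp add: mult algebra_simps)
      have r2: "c a * ?\<chi> a y * ?\<chi> a z + (\<Sum>b\<in>A. c b * ?\<chi> b y * ?\<chi> a z) = 0"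
        using arg_cong[OF rel[OF y], of "\<lambda>u. u * ?\<chi> a z"]
        by (simp add: sum_distrib_right distrib_right)
      have "(\<Sum>b\<in>A. c b * ?\<chi> b y * ?\<chi> b z) = (\<Sum>b\<in>A. c b * ?\<chi> b y * ?\<chi> a z)"
        by (rule add_left_imp_eq[OF trans[OF r1 r2[symmetric]]])
      then show "sum_eval A (\<lambda>b. c b * (?\<chi> b z - ?\<chi> a z)) (coord_powi e y) = 0"
        by (simp add: sum_eval_def algebra_simps sum_subtractf)
    qed
    with b show ?thesis by blast
  qed
  note zero = this
  have cA: "c b = 0" if b: "b \<in> A" for b
  proof -
    have "b \<noteq> a" using b insert.hyps by auto
    then obtain j where j: "Poly_Mapping.lookup b j \<noteq> Poly_Mapping.lookup a j"
      by (meson poly_mapping_eqI)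
    \<comment> \<open>Scaling only coordinate \<open>j\<close> by 2 separates the two characters:
      their values are powers of 2 with different exponents and hence differ in norm.\<close>
    define z :: "'a \<Rightarrow> complex" where "z = (\<lambda>i. if i = j then 2 else 1)"
    have z: "z \<in> torus" by (simp add: z_def torus_def)
    have \<chi>z: "?\<chi> u z = 2 powi (e j * Poly_Mapping.lookup u j)" for u :: "'a \<Rightarrow>\<^sub>0 int"
    proof -
      have "?\<chi> u z = (\<Prod>i\<in>UNIV. if i = j then 2 powi (e j * Poly_Mapping.lookup u j) else 1)"
        unfolding mono_eval_def coord_powi_def
        by (intro prod.cong) (auto simp: z_def power_int_mult)
      then show ?thesis by simp
    qed
    have "?\<chi> b z \<noteq> ?\<chi> a z"
    proof
      assume "?\<chi> b z = ?\<chi> a z"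
      then have "(2::complex) powi (e j * Poly_Mapping.lookup b j) = 2 powi (e j * Poly_Mapping.lookup a j)"
        by (simp only: \<chi>z)
      then have "norm ((2::complex) powi (e j * Poly_Mapping.lookup b j)) =
          norm ((2::complex) powi (e j * Poly_Mapping.lookup a j))" by simp
      then have "(2::real) powi (e j * Poly_Mapping.lookup b j) = 2 powi (e j * Poly_Mapping.lookup a j)"
        by (simp add: norm_power_int)
      then have "e j * Poly_Mapping.lookup b j = e j * Poly_Mapping.lookup a j"
        by (smt (verit) power_int_strict_increasing)
      with j e[of j] show False by simp
    qed
    with zero[OF b z] show ?thesis by simp
  qed
  have one: "(\<lambda>_. 1) \<in> torus" by (simp add: torus_def)
  have "c a * ?\<chi> a (\<lambda>_. 1) = 0" using rel[OF one] cA by simp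
  then have "c a = 0" using mono_eval_nonzero[OF coord_powi_torus[OF one], of a e] by simp
  with cA show ?case by simp
qed

lemma sum_eval_nonzero_exists:
  assumes "finite A" "\<And>j. e j \<noteq> 0" "a \<in> A" "c a \<noteq> 0"
  obtains y where "y \<in> torus" "sum_eval A c (coord_powi e y) \<noteq> 0"
  using mono_eval_lin_indep[of A e c] assms by blast

section \<open>Generic points on complex lines\<close>

text \<open>\<open>line_open\<close> is a substitute for Zariski-openness, stable under intersections.\<close>

definition line_open :: "('d \<Rightarrow> complex) set \<Rightarrow> bool" where
  "line_open B \<longleftrightarrow> (\<forall>y\<in>B. \<forall>v. finite {t. (\<lambda>j. y j + t * v j) \<notin> B})"

lemma line_open_Int:
  assumes "line_open A" "line_open B"
  shows "line_open (A \<inter> B)"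
proof -
  have "{t. (\<lambda>j. y j + t * v j) \<notin> A \<inter> B} =
      {t. (\<lambda>j. y j + t * v j) \<notin> A} \<union> {t. (\<lambda>j. y j + t * v j) \<notin> B}" for y v
    by blast
  with assms show ?thesis by (auto simp: line_open_def)
qed

text \<open>On the complex line through \<open>y\<close> and \<open>z\<close> each set misses only
  finitely many parameters. Openness of \<open>B\<close> is measured from its own point
  \<open>z\<close>, so the substitution of \<open>1 - t\<close> for \<open>t\<close> brings both
  exceptional sets to one parametrization.\<close>

lemma line_open_common_point:
  assumes "line_open A" "line_open B" "y \<in> A" "z \<in> B"
  obtains t where "(\<lambda>j. y j + t * (z j - y j)) \<in> A \<inter> B"
proof -
  let ?l = "\<lambda>t j. y j + t * (z j - y j)"
  let ?m = "\<lambda>t j. z j + t * (y j - z j)"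
  have A: "finite {t. ?l t \<notin> A}" and B: "finite {t. ?m t \<notin> B}"
    using assms by (auto simp: line_open_def)
  have eq: "?m (1 - t) = ?l t" for t by (auto simp: algebra_simps)
  have "{t. ?l t \<notin> B} \<subseteq> (\<lambda>t. 1 - t) ` {t. ?m t \<notin> B}"
  proof
    fix t assume "t \<in> {t. ?l t \<notin> B}"
    then have "1 - t \<in> {t. ?m t \<notin> B}" using eq[of t] by simp
    then have "1 - (1 - t) \<in> (\<lambda>t. 1 - t) ` {t. ?m t \<notin> B}" by blast
    then show "t \<in> (\<lambda>t. 1 - t) ` {t. ?m t \<notin> B}" by simp
  qed
  then have "finite ({t. ?l t \<notin> A} \<union> {t. ?l t \<notin> B})"
    using A B by (meson finite_UnI finite_imageI finite_subset)
  then obtain t where "t \<notin> {t. ?l t \<notin> A} \<union> {t. ?l t \<notin> B}"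
    using ex_new_if_finite infinite_UNIV_char_0 by blast
  then show ?thesis using that by blast
qed

lemma line_open_Int_nonempty:
  assumes "line_open A" "line_open B" "A \<noteq> {}" "B \<noteq> {}"
  shows "A \<inter> B \<noteq> {}"
  using assms line_open_common_point by (metis all_not_in_conv)

lemma line_open_INT_nonempty:
  assumes "finite I" "line_open A" "A \<noteq> {}"
    and "\<And>i. i \<in> I \<Longrightarrow> line_open (B i)" "\<And>i. i \<in> I \<Longrightarrow> B i \<noteq> {}"
  shows "line_open (A \<inter> (\<Inter>i\<in>I. B i)) \<and> A \<inter> (\<Inter>i\<in>I. B i) \<noteq> {}"
  using assms(1,4,5)
proof (induction I)
  case empty
  then show ?case using assms(2,3) by simp
next
  case (insert i I)
  then have "line_open (A \<inter> \<Inter>(B ` I))" "A \<inter> \<Inter>(B ` I) \<noteq> {}" "line_open (B i)" "B i \<noteq> {}" by auto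
  from line_open_Int[OF this(1,3)] line_open_Int_nonempty[OF this(1,3,2,4)] show ?case
    by (simp add: Int_ac)
qed

text \<open>Polynomial functions are seen only through their restrictions to lines, which is all
  that finiteness of roots needs; no encoding of multivariate polynomials is involved.\<close>

definition poly_on_lines :: "(('d \<Rightarrow> complex) \<Rightarrow> complex) \<Rightarrow> bool" where
  "poly_on_lines u \<longleftrightarrow> (\<forall>y v. \<exists>p. \<forall>t. u (\<lambda>j. y j + t * v j) = poly p t)"

lemma poly_on_lines_const: "poly_on_lines (\<lambda>_. c)"
  unfolding poly_on_lines_def by (metis poly_const_conv)

lemma poly_on_lines_coord: "poly_on_lines (\<lambda>y. y j)"
  unfolding poly_on_lines_def
proof (intro allI)
  fix y v :: "'a \<Rightarrow> complex"
  have "\<forall>t. y j + t * v j = poly [:y j, v j:] t" by simp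
  then show "\<exists>p. \<forall>t. y j + t * v j = poly p t" by blast
qed

lemma poly_on_lines_add:
  assumes "poly_on_lines f" "poly_on_lines g" shows "poly_on_lines (\<lambda>y. f y + g y)"
  using assms unfolding poly_on_lines_def by (metis poly_add)

lemma poly_on_lines_mult:
  assumes "poly_on_lines f" "poly_on_lines g" shows "poly_on_lines (\<lambda>y. f y * g y)"
  using assms unfolding poly_on_lines_def by (metis poly_mult)

lemma poly_on_lines_power:
  assumes "poly_on_lines f" shows "poly_on_lines (\<lambda>y. f y ^ n)"
  using assms unfolding poly_on_lines_def by (metis poly_power)

lemma poly_on_lines_sum:
  assumes "\<And>i. i \<in> I \<Longrightarrow> poly_on_lines (f i)"
  shows "poly_on_lines (\<lambda>y. \<Sum>i\<in>I. f i y)"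
  using assms
  by (induction I rule: infinite_finite_induct) (auto intro: poly_on_lines_const poly_on_lines_add)

lemma poly_on_lines_prod:
  assumes "\<And>i. i \<in> I \<Longrightarrow> poly_on_lines (f i)"
  shows "poly_on_lines (\<lambda>y. \<Prod>i\<in>I. f i y)"
  using assms
  by (induction I rule: infinite_finite_induct) (auto intro: poly_on_lines_const poly_on_lines_mult)

lemma line_open_nonzero:
  assumes "poly_on_lines u"
  shows "line_open {y. u y \<noteq> 0}"
  unfolding line_open_def
proof (intro ballI allI)
  fix y v assume y: "y \<in> {y. u y \<noteq> 0}"
  obtain p where p: "\<And>t. u (\<lambda>j. y j + t * v j) = poly p t"
    using assms unfolding poly_on_lines_def by meson
  have "poly p 0 \<noteq> 0" using p[of 0] y by simp
  then have "p \<noteq> 0" by auto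
  then show "finite {t. (\<lambda>j. y j + t * v j) \<notin> {y. u y \<noteq> 0}}"
    using poly_roots_finite[of p] by (simp add: p)
qed

text \<open>Clearing denominators turns the Laurent sum into a polynomial function with the same
  zeros on the torus; an extra factor, the product of all coordinates, makes it vanish off the
  torus.\<close>

lemma line_open_sum_eval:
  fixes e :: "'d::finite \<Rightarrow> int"
  assumes A: "finite A"
  shows "line_open {y\<in>torus. sum_eval A c (coord_powi e y) \<noteq> 0}"
proof -
  \<comment> \<open>A crude common bound for all exponents: after a shift by \<open>N\<close> each
    of them is nonnegative.\<close>
  define N where "N = (\<Sum>a\<in>A. \<Sum>j\<in>UNIV. \<bar>e j * Poly_Mapping.lookup a j\<bar>)"
  have N: "0 \<le> e j * Poly_Mapping.lookup a j + N" if "a \<in> A" for a j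
  proof -
    have "\<bar>e j * Poly_Mapping.lookup a j\<bar> \<le> (\<Sum>j\<in>UNIV. \<bar>e j * Poly_Mapping.lookup a j\<bar>)"
      by (rule member_le_sum) auto
    also have "\<dots> \<le> N"
      unfolding N_def by (rule member_le_sum[OF that]) (auto simp: A intro: sum_nonneg)
    finally show ?thesis by linarith
  qed
  define u where "u y = (\<Prod>j\<in>UNIV. y j) *
    (\<Sum>a\<in>A. c a * (\<Prod>j\<in>UNIV. y j ^ nat (e j * Poly_Mapping.lookup a j + N)))" for y :: "'d \<Rightarrow> complex"
  have "poly_on_lines u"
    unfolding u_def
    by (intro poly_on_lines_mult poly_on_lines_prod poly_on_lines_sum poly_on_lines_const
        poly_on_lines_power poly_on_lines_coord)
  moreover have "{y\<in>torus. sum_eval A c (coord_powi e y) \<noteq> 0} = {y. u y \<noteq> 0}"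
  proof -
    have "u y = (\<Prod>j\<in>UNIV. y j) * (sum_eval A c (coord_powi e y) * (\<Prod>j\<in>UNIV. y j powi N))"
      if y: "y \<in> torus" for y
    proof -
      have "(\<Prod>j\<in>UNIV. y j ^ nat (e j * Poly_Mapping.lookup a j + N)) =
          mono_eval a (coord_powi e y) * (\<Prod>j\<in>UNIV. y j powi N)" if "a \<in> A" for a
      proof -
        have "y j ^ nat (e j * Poly_Mapping.lookup a j + N) =
            (y j powi e j) powi Poly_Mapping.lookup a j * y j powi N" for j
        proof -
          have "y j ^ nat (e j * Poly_Mapping.lookup a j + N) = y j powi (e j * Poly_Mapping.lookup a j + N)"
            using N[OF that, of j] by (simp add: power_int_def)
          then show ?thesis using y by (simp add: torus_def power_int_add power_int_mult)
        qed
        then show ?thesis by (simp add: mono_eval_def coord_powi_def prod.distrib)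
      qed
      then show ?thesis
        by (simp add: u_def sum_eval_def sum_distrib_right mult.assoc)
    qed
    moreover have "u y = 0" if "y \<notin> torus" for y using that by (auto simp: u_def torus_def)
    moreover have "(\<Prod>j\<in>UNIV. y j) \<noteq> 0" "(\<Prod>j\<in>UNIV. y j powi N) \<noteq> 0" if "y \<in> torus" for y :: "'d \<Rightarrow> complex"
      using that by (simp_all add: torus_def)
    ultimately have "y \<in> torus \<and> sum_eval A c (coord_powi e y) \<noteq> 0 \<longleftrightarrow> u y \<noteq> 0" for y
      by (cases "y \<in> torus") simp_all
    then show ?thesis by simp
  qed
  ultimately show ?thesis using line_open_nonzero by metis
qed

section \<open>Leading parts as scaling limits\<close>

lemma of_nat_powi_tendsto_0:
  assumes "m < 0"
  shows "(\<lambda>n. complex_of_nat (Suc n) powi m) \<longlonglongrightarrow> 0"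
proof -
  have "(\<lambda>n. inverse (complex_of_nat (Suc n)) ^ nat (- m)) \<longlonglongrightarrow> 0 ^ nat (- m)"
    by (intro tendsto_power LIMSEQ_Suc[OF lim_inverse_n])
  then show ?thesis using assms by (simp add: power_int_def power_0_left del: of_nat_Suc)
qed

text \<open>With \<open>t = Suc n\<close>, a term of weight \<open>m\<close> scales like
  \<open>t powi (m - H)\<close> after normalization, so only weight \<open>H\<close> survives.
  \<open>H\<close> need only be an upper bound; if it is not attained, the limit is 0.\<close>

lemma sum_eval_scaling_limit:
  assumes A: "finite A" and H: "\<And>a. a \<in> A \<Longrightarrow> weight v a \<le> H"
  shows "(\<lambda>n. sum_eval A c (\<lambda>j. z j * of_nat (Suc n) powi v j) * of_nat (Suc n) powi (- H))
    \<longlonglongrightarrow> sum_eval {a\<in>A. weight v a = H} c z"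
proof -
  have eq: "sum_eval A c (\<lambda>j. z j * of_nat (Suc n) powi v j) * of_nat (Suc n) powi (- H) =
      (\<Sum>a\<in>A. c a * mono_eval a z * of_nat (Suc n) powi (weight v a - H))" for n
  proof -
    have nz: "complex_of_nat (Suc n) \<noteq> 0" by (rule of_nat_neq_0)
    show ?thesis
      unfolding sum_eval_def mono_eval_scale[OF nz] sum_distrib_right
      by (intro sum.cong refl) (simp only: diff_conv_add_uminus power_int_add[OF disjI1[OF nz]] mult.assoc)
  qed
  have "(\<lambda>n. c a * mono_eval a z * of_nat (Suc n) powi (weight v a - H))
      \<longlonglongrightarrow> (if weight v a = H then c a * mono_eval a z else 0)" if "a \<in> A" for a
  proof (cases "weight v a = H")
    case False
    then have "weight v a - H < 0" using H[OF that] by simp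
    from tendsto_mult_right_zero[OF of_nat_powi_tendsto_0[OF this], of "c a * mono_eval a z"] False
    show ?thesis by (simp del: of_nat_Suc)
  qed simp
  then have "(\<lambda>n. \<Sum>a\<in>A. c a * mono_eval a z * of_nat (Suc n) powi (weight v a - H))
      \<longlonglongrightarrow> (\<Sum>a\<in>A. if weight v a = H then c a * mono_eval a z else 0)"
    by (rule tendsto_sum)
  also have "(\<Sum>a\<in>A. if weight v a = H then c a * mono_eval a z else 0) = sum_eval {a\<in>A. weight v a = H} c z"
    unfolding sum_eval_def using A by (simp add: sum.inter_filter)
  finally show ?thesis by (simp only: eq)
qed

subsection \<open>Products of linear forms\<close>

text \<open>A univariate Laurent polynomial with two nonzero coefficients is not a unit, so over the
  complex numbers it has a nonzero root. Terms with equal exponents may cancel, hence the hypotheses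
  on grouped coefficients.\<close>

lemma laurent_sum_has_nonzero_root:
  fixes C :: "'a \<Rightarrow> complex" and m :: "'a \<Rightarrow> int"
  assumes A: "finite A" and "\<alpha> \<noteq> \<beta>"
    and \<alpha>: "(\<Sum>a\<in>{a\<in>A. m a = \<alpha>}. C a) \<noteq> 0" and \<beta>: "(\<Sum>a\<in>{a\<in>A. m a = \<beta>}. C a) \<noteq> 0"
  obtains \<tau> where "\<tau> \<noteq> 0" "(\<Sum>a\<in>A. C a * \<tau> powi m a) = 0"
proof -
  define N where "N = (\<Sum>a\<in>A. \<bar>m a\<bar>) + \<bar>\<alpha>\<bar> + \<bar>\<beta>\<bar>"
  have N: "0 \<le> m a + N" if "a \<in> A" for a
    using member_le_sum[OF that, of "\<lambda>a. \<bar>m a\<bar>"] A by (simp add: N_def)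
  have N': "0 \<le> \<alpha> + N" "0 \<le> \<beta> + N" using sum_nonneg[of A "\<lambda>a. \<bar>m a\<bar>"] unfolding N_def by linarith+
  define p where "p = (\<Sum>a\<in>A. monom (C a) (nat (m a + N)))"
  have coeff: "coeff p (nat (\<mu> + N)) = (\<Sum>a\<in>{a\<in>A. m a = \<mu>}. C a)" if "0 \<le> \<mu> + N" for \<mu>
  proof -
    have "coeff p (nat (\<mu> + N)) = (\<Sum>a\<in>A. if m a = \<mu> then C a else 0)"
      unfolding p_def coeff_sum
    proof (intro sum.cong refl)
      fix a assume "a \<in> A"
      from N[OF this] that show "coeff (monom (C a) (nat (m a + N))) (nat (\<mu> + N)) = (if m a = \<mu> then C a else 0)"
        by (auto simp: nat_eq_iff)
    qed
    then show ?thesis by (simp add: sum.inter_filter A)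
  qed
  have ca: "coeff p (nat (\<alpha> + N)) \<noteq> 0" and cb: "coeff p (nat (\<beta> + N)) \<noteq> 0"
    using coeff N' \<alpha> \<beta> by simp_all
  then have "p \<noteq> 0" by auto
  \<comment> \<open>Splitting off the largest power of the variable leaves \<open>r\<close> with
    nonzero constant term; the two nonzero coefficients of \<open>p\<close> prevent \<open>r\<close>
    from being constant.\<close>
  from order_decomp[OF this, of 0] obtain r
    where r: "p = [:0, 1:] ^ order 0 p * r" "\<not> [:0, 1:] dvd r" by auto
  have r0: "poly r 0 \<noteq> 0" using r(2) by (simp add: poly_eq_0_iff_dvd)
  have "degree r \<noteq> 0"
  proof
    assume "degree r = 0"
    then obtain u where "r = [:u:]" by (meson degree_eq_zeroE)
    then have "p = monom u (order 0 p)" using r(1) by (simp add: monom_altdef)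
    then have "nat (\<alpha> + N) = order 0 p" "nat (\<beta> + N) = order 0 p"
      using ca cb by (metis coeff_monom)+
    then show False using N' \<open>\<alpha> \<noteq> \<beta>\<close> by auto
  qed
  then obtain \<tau> where \<tau>: "poly r \<tau> = 0"
    using fundamental_theorem_of_algebra[of r] constant_degree[of r] by auto
  have "\<tau> \<noteq> 0" using \<tau> r0 by auto
  have "poly p \<tau> = 0" by (subst r(1)) (simp add: \<tau>)
  moreover have "poly p \<tau> = (\<Sum>a\<in>A. C a * \<tau> powi m a) * \<tau> powi N"
  proof -
    have "\<tau> ^ nat (m a + N) = \<tau> powi m a * \<tau> powi N" if "a \<in> A" for a
    proof -
      have "\<tau> ^ nat (m a + N) = \<tau> powi (m a + N)" using N[OF that] by (simp add: power_int_def)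
      then show ?thesis using \<open>\<tau> \<noteq> 0\<close> by (simp add: power_int_add)
    qed
    then show ?thesis by (simp add: p_def poly_sum poly_monom sum_distrib_right mult.assoc)
  qed
  ultimately show ?thesis using that \<open>\<tau> \<noteq> 0\<close> by simp
qed

lemma mono_eval_coord_scale:
  "mono_eval a (coord_powi e (\<lambda>i. y i * (if i = j then \<tau> else 1))) =
   mono_eval a (coord_powi e y) * \<tau> powi (e j * Poly_Mapping.lookup a j)"
proof -
  have "mono_eval a (coord_powi e (\<lambda>i. if i = j then \<tau> else 1)) =
      (\<Prod>i\<in>UNIV. if i = j then \<tau> powi (e j * Poly_Mapping.lookup a j) else 1)"
    unfolding mono_eval_def coord_powi_def by (intro prod.cong) (auto simp: power_int_mult)
  then show ?thesis
    by (simp add: coord_powi_def power_int_mult_distrib mono_eval_mult)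
qed

lemma sum_eval_coord_scale_has_derivative:
  assumes "\<tau> \<noteq> 0"
  shows "\<exists>D. ((\<lambda>\<tau>. sum_eval A c (coord_powi e (\<lambda>i. y i * (if i = j then \<tau> else 1))))
    has_field_derivative D) (at \<tau>)"
  unfolding sum_eval_def mono_eval_coord_scale
  by (rule exI, (rule derivative_eq_intros refl disjI2[OF assms])+)

text \<open>A model of the facet polynomials. By \<open>\<omega>_powi\<close>, coordinatewise
  multiplication of \<open>y\<close> by \<open>\<omega> k\<close> moves the hyperplanes but fixes
  \<open>coord_powi e y\<close>; \<open>\<omega>_distinct\<close> makes the forms pairwise
  non-proportional, so that their product is squarefree.\<close>

locale hyperplane_product =
  fixes K :: "'k set" and \<omega> :: "'k \<Rightarrow> 'd::finite \<Rightarrow> complex" and e :: "'d \<Rightarrow> int"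
  assumes finite_K: "finite K" and K_nonempty: "K \<noteq> {}"
    and e_nonzero: "\<And>j. e j \<noteq> 0"
    and \<omega>_powi: "\<And>k j. k \<in> K \<Longrightarrow> \<omega> k j powi e j = 1"
    and \<omega>_distinct: "\<And>k k' s. k \<in> K \<Longrightarrow> k' \<in> K \<Longrightarrow> k \<noteq> k' \<Longrightarrow> \<exists>j. \<omega> k j \<noteq> s * \<omega> k' j"
begin

definition form :: "'k \<Rightarrow> ('d \<Rightarrow> complex) \<Rightarrow> complex" where
  "form k y = (\<Sum>j\<in>UNIV. \<omega> k j * y j)"

lemma \<omega>_nonzero: "k \<in> K \<Longrightarrow> \<omega> k j \<noteq> 0"
  using \<omega>_powi[of k j] e_nonzero[of j] by force

text \<open>Coordinatewise multiplication by \<open>\<omega> k' i / \<omega> k i\<close> carries the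
  hyperplane of \<open>k'\<close> to that of \<open>k\<close> and fixes
  \<open>coord_powi e y\<close>. A factor in these powers therefore cannot single out one
  hyperplane.\<close>

lemma vanishing_transfer:
  assumes k: "k \<in> K" and k': "k' \<in> K"
    and van: "\<And>y. y \<in> torus \<Longrightarrow> form k y = 0 \<Longrightarrow> sum_eval A c (coord_powi e y) = 0"
    and y: "y \<in> torus" "form k' y = 0"
  shows "sum_eval A c (coord_powi e y) = 0"
proof -
  let ?y = "\<lambda>i. y i * (\<omega> k' i / \<omega> k i)"
  have "?y \<in> torus" using y \<omega>_nonzero k k' by (simp add: torus_def)
  moreover have "form k ?y = form k' y"
    unfolding form_def by (intro sum.cong) (auto simp: \<omega>_nonzero[OF k])
  moreover have "coord_powi e ?y = coord_powi e y"
    by (rule ext) (simp add: coord_powi_def power_int_mult_distrib power_int_divide_distrib \<omega>_powi k k')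
  ultimately show ?thesis using van[of ?y] y by simp
qed

text \<open>If one factor vanishes on the hyperplanes, a zero of the other one on a generic coordinate
  line would be a double zero of the product, whose zeros on that line are simple.\<close>

lemma cofactor_single_term:
  assumes A: "finite A" and B: "finite B" "\<And>b. b \<in> B \<Longrightarrow> c' b \<noteq> 0"
    and eq: "\<And>y. y \<in> torus \<Longrightarrow>
      sum_eval A c (coord_powi e y) * sum_eval B c' (coord_powi e y) = (\<Prod>k\<in>K. - form k y)"
    and k0: "k0 \<in> K" and van: "\<And>y. y \<in> torus \<Longrightarrow> form k0 y = 0 \<Longrightarrow> sum_eval A c (coord_powi e y) = 0"
    and b: "b \<in> B" "b' \<in> B"
  shows "b = b'"
proof (rule ccontr)
  assume "b \<noteq> b'"
  then obtain j where j: "Poly_Mapping.lookup b j \<noteq> Poly_Mapping.lookup b' j"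
    by (meson poly_mapping_eqI)
  \<comment> \<open>Terms are grouped by their exponent in coordinate \<open>j\<close>. If the
    groups of \<open>b\<close> and \<open>b'\<close> are both nonzero at \<open>y\<close>, the
    restriction to the coordinate line has two distinct exponents and hence a nonzero root.\<close>
  define Bm where "Bm \<mu> = {b\<in>B. Poly_Mapping.lookup b j = \<mu>}" for \<mu>
  define U where "U \<mu> = {y\<in>torus. sum_eval (Bm \<mu>) c' (coord_powi e y) \<noteq> 0}" for \<mu>
  have U: "line_open (U (Poly_Mapping.lookup x j))" "U (Poly_Mapping.lookup x j) \<noteq> {}" if "x \<in> B" for x
  proof -
    have fin: "finite (Bm (Poly_Mapping.lookup x j))" using B by (simp add: Bm_def)
    show "line_open (U (Poly_Mapping.lookup x j))" unfolding U_def by (rule line_open_sum_eval[OF fin])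
    have "x \<in> Bm (Poly_Mapping.lookup x j)" using that by (simp add: Bm_def)
    from sum_eval_nonzero_exists[of _ e x c', OF fin e_nonzero this B(2)[OF that]]
    show "U (Poly_Mapping.lookup x j) \<noteq> {}" unfolding U_def by blast
  qed
  \<comment> \<open>Both forms are normalized to coefficient 1 at \<open>j\<close>, so their
    difference does not involve coordinate \<open>j\<close>. Where this difference is nonzero, the
    two forms have no common zero on the line in direction \<open>j\<close>.\<close>
  define d where "d = (\<lambda>(k, k') i. \<omega> k i / \<omega> k j - \<omega> k' i / \<omega> k' j)"
  define Y where "Y p = {y. (\<Sum>i\<in>UNIV. d p i * y i) \<noteq> 0}" for p
  define I where "I = {(k, k'). k \<in> K \<and> k' \<in> K \<and> k \<noteq> k'}"
  have "finite I" by (rule finite_subset[of _ "K \<times> K"]) (auto simp: I_def finite_K)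
  have Y_open: "line_open (Y p)" for p
    unfolding Y_def
    by (intro line_open_nonzero poly_on_lines_sum poly_on_lines_mult poly_on_lines_const poly_on_lines_coord)
  have Y_nonempty: "Y p \<noteq> {}" if "p \<in> I" for p
  proof -
    obtain k k' where p: "p = (k, k')" "k \<in> K" "k' \<in> K" "k \<noteq> k'" using \<open>p \<in> I\<close> by (auto simp: I_def)
    obtain i where "\<omega> k i \<noteq> (\<omega> k j / \<omega> k' j) * \<omega> k' i"
      using \<omega>_distinct[OF p(2-4)] by metis
    then have "d p i \<noteq> 0" using \<omega>_nonzero[OF p(2)] \<omega>_nonzero[OF p(3)] by (simp add: d_def p field_simps)
    moreover have "(\<Sum>l\<in>UNIV. d p l * (if l = i then 1 else 0)) = d p i"
      by (simp add: if_distrib cong: if_cong)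
    ultimately have "(\<lambda>l. if l = i then 1 else 0) \<in> Y p" by (simp add: Y_def)
    then show ?thesis by blast
  qed
  have "U (Poly_Mapping.lookup b j) \<inter> U (Poly_Mapping.lookup b' j) \<inter> (\<Inter>p\<in>I. Y p) \<noteq> {}"
    using line_open_INT_nonempty[OF \<open>finite I\<close>, of "U (Poly_Mapping.lookup b j) \<inter> U (Poly_Mapping.lookup b' j)" Y]
      line_open_Int[OF U(1)[OF b(1)] U(1)[OF b(2)]] line_open_Int_nonempty[OF U(1)[OF b(1)] U(1)[OF b(2)]]
      U(2) b Y_open Y_nonempty by blast
  then obtain y where yb: "y \<in> U (Poly_Mapping.lookup b j)" "y \<in> U (Poly_Mapping.lookup b' j)"
    and yY: "\<And>p. p \<in> I \<Longrightarrow> y \<in> Y p" by blast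
  have y: "y \<in> torus" using yb by (simp add: U_def)
  define z where "z \<tau> = (\<lambda>i. y i * (if i = j then \<tau> else 1))" for \<tau>
  define C where "C b = c' b * mono_eval b (coord_powi e y)" for b
  have group: "(\<Sum>a\<in>{a\<in>B. e j * Poly_Mapping.lookup a j = e j * \<mu>}. C a) = sum_eval (Bm \<mu>) c' (coord_powi e y)" for \<mu>
    using e_nonzero[of j] by (simp add: sum_eval_def Bm_def C_def)
  obtain \<tau> where \<tau>: "\<tau> \<noteq> 0" "(\<Sum>a\<in>B. C a * \<tau> powi (e j * Poly_Mapping.lookup a j)) = 0"
  proof (rule laurent_sum_has_nonzero_root[OF B(1)])
    show "e j * Poly_Mapping.lookup b j \<noteq> e j * Poly_Mapping.lookup b' j"
      using j e_nonzero[of j] by simp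
    show "(\<Sum>a\<in>{a\<in>B. e j * Poly_Mapping.lookup a j = e j * Poly_Mapping.lookup b j}. C a) \<noteq> 0"
      "(\<Sum>a\<in>{a\<in>B. e j * Poly_Mapping.lookup a j = e j * Poly_Mapping.lookup b' j}. C a) \<noteq> 0"
      using yb unfolding group U_def by simp_all
  qed
  have G0: "sum_eval B c' (coord_powi e (z \<tau>)) = 0"
    using \<tau>(2) unfolding sum_eval_def z_def mono_eval_coord_scale C_def by (simp add: mult.assoc)
  have zt: "z t \<in> torus" if "t \<noteq> 0" for t using y that by (simp add: z_def torus_def)
  \<comment> \<open>The cofactor vanishes at this point, so some form does;
    \<open>vanishing_transfer\<close> then makes the first factor vanish there too.\<close>
  obtain k where k: "k \<in> K" "form k (z \<tau>) = 0"
    using eq[OF zt[OF \<tau>(1)]] G0 finite_K by auto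
  have F0: "sum_eval A c (coord_powi e (z \<tau>)) = 0"
    by (rule vanishing_transfer[OF k0 k(1) van zt[OF \<tau>(1)] k(2)])
  have other: "form k' (z \<tau>) \<noteq> 0" if k': "k' \<in> K" "k' \<noteq> k" for k'
  proof
    assume 0: "form k' (z \<tau>) = 0"
    have "(\<Sum>i\<in>UNIV. d (k, k') i * z \<tau> i) = form k (z \<tau>) / \<omega> k j - form k' (z \<tau>) / \<omega> k' j"
      by (simp add: form_def d_def sum_divide_distrib flip: sum_subtractf) (simp add: algebra_simps)
    then have "(\<Sum>i\<in>UNIV. d (k, k') i * z \<tau> i) = 0" using k 0 by simp
    moreover have "d (k, k') i * z \<tau> i = d (k, k') i * y i" for i
      using \<omega>_nonzero[OF k(1)] \<omega>_nonzero[OF k'(1)] by (cases "i = j") (simp_all add: d_def z_def)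
    ultimately have "y \<notin> Y (k, k')" by (simp add: Y_def)
    with yY[of "(k, k')"] k k' show False by (auto simp: I_def)
  qed
  define l where "l k = [:\<Sum>i\<in>UNIV-{j}. \<omega> k i * y i, \<omega> k j * y j:]" for k
  have l: "form k (z t) = poly (l k) t" for k t
  proof -
    have "form k (z t) = \<omega> k j * z t j + (\<Sum>i\<in>UNIV-{j}. \<omega> k i * z t i)"
      unfolding form_def by (rule sum.remove) auto
    also have "(\<Sum>i\<in>UNIV-{j}. \<omega> k i * z t i) = (\<Sum>i\<in>UNIV-{j}. \<omega> k i * y i)"
      by (rule sum.cong) (auto simp: z_def)
    finally show ?thesis by (simp add: l_def z_def algebra_simps)
  qed
  let ?R = "\<Prod>k'\<in>K-{k}. - l k'"
  have R: "poly ?R \<tau> \<noteq> 0" using other finite_K by (simp add: poly_prod l)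
  have prod: "(\<Prod>k\<in>K. - form k (z t)) = - poly (l k) t * poly ?R t" for t
    using prod.remove[OF finite_K k(1), of "\<lambda>k. - form k (z t)"] by (simp add: poly_prod l)
  let ?F = "\<lambda>t. sum_eval A c (coord_powi e (z t))" and ?G = "\<lambda>t. sum_eval B c' (coord_powi e (z t))"
  obtain DF DG where D: "(?F has_field_derivative DF) (at \<tau>)" "(?G has_field_derivative DG) (at \<tau>)"
    using sum_eval_coord_scale_has_derivative[OF \<tau>(1), of A c e y j]
      sum_eval_coord_scale_has_derivative[OF \<tau>(1), of B c' e y j] unfolding z_def by blast
  \<comment> \<open>Both factors vanish at \<open>\<tau>\<close>, so the product rule gives
    derivative 0.\<close>
  have "((\<lambda>t. ?F t * ?G t) has_field_derivative 0) (at \<tau>)"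
    using DERIV_mult[OF D] by (simp add: F0 G0)
  then have "((\<lambda>t. poly (- l k * ?R) t) has_field_derivative 0) (at \<tau>)"
  \<comment> \<open>The factorization is known only for \<open>t \<noteq> 0\<close>, where the
    scaled point stays in the torus.\<close>
  proof (rule has_field_derivative_transform_within_open[where S = "- {0}"])
    fix t :: complex assume "t \<in> - {0}"
    then show "?F t * ?G t = poly (- l k * ?R) t" using eq[OF zt, of t] prod[of t] by simp
  qed (use \<tau> in auto)
  then have "poly (pderiv (- l k * ?R)) \<tau> = 0"
    using DERIV_unique[OF poly_DERIV] by blast
  \<comment> \<open>On the other side the zero is simple: \<open>l k\<close> is linear with nonzero
    slope, and the remaining forms do not vanish at \<open>\<tau>\<close>.\<close>
  moreover have "poly (pderiv (- l k * ?R)) \<tau> = - (\<omega> k j * y j) * poly ?R \<tau>"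
    using k(2) by (simp add: pderiv_mult pderiv_minus l) (simp add: l_def pderiv_pCons)
  ultimately show False using R \<omega>_nonzero[OF k(1)] y by (simp add: torus_def)
qed

text \<open>Hyperplanes are irreducible because two points on one are joined by a line inside it.\<close>

lemma factor_single_term:
  assumes A: "finite A" "\<And>a. a \<in> A \<Longrightarrow> c a \<noteq> 0" and B: "finite B" "\<And>b. b \<in> B \<Longrightarrow> c' b \<noteq> 0"
    and eq: "\<And>y. y \<in> torus \<Longrightarrow>
      sum_eval A c (coord_powi e y) * sum_eval B c' (coord_powi e y) = (\<Prod>k\<in>K. - form k y)"
  shows "(\<forall>a\<in>A. \<forall>a'\<in>A. a = a') \<or> (\<forall>b\<in>B. \<forall>b'\<in>B. b = b')"
proof -
  obtain k where k: "k \<in> K" using K_nonempty by blast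
  show ?thesis
  \<comment> \<open>If the first factor does not vanish on the whole hyperplane of \<open>k\<close>,
    the second one must; whichever vanishes forces the other to be a single term.\<close>
  proof (cases "\<forall>y\<in>torus. form k y = 0 \<longrightarrow> sum_eval A c (coord_powi e y) = 0")
    case True
    have "b = b'" if "b \<in> B" "b' \<in> B" for b b'
      by (rule cofactor_single_term[OF A(1) B eq k _ that]) (use True in auto)
    then show ?thesis by blast
  next
    case False
    then obtain y where y: "y \<in> torus" "form k y = 0" "sum_eval A c (coord_powi e y) \<noteq> 0" by blast
    have "sum_eval B c' (coord_powi e z) = 0" if z: "z \<in> torus" "form k z = 0" for z
    proof (rule ccontr)
      assume nz: "sum_eval B c' (coord_powi e z) \<noteq> 0"
      obtain t where t: "(\<lambda>j. y j + t * (z j - y j)) \<in>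
          {y\<in>torus. sum_eval A c (coord_powi e y) \<noteq> 0} \<inter> {y\<in>torus. sum_eval B c' (coord_powi e y) \<noteq> 0}"
        by (rule line_open_common_point[OF line_open_sum_eval[OF A(1)] line_open_sum_eval[OF B(1)], of y _ e z _ e])
           (use y z nz in auto)
      let ?x = "\<lambda>j. y j + t * (z j - y j)"
      have "form k ?x = form k y + t * (form k z - form k y)"
        by (simp add: form_def sum.distrib sum_subtractf sum_distrib_left algebra_simps)
      then have "form k ?x = 0" using y z by simp
      then have "(\<Prod>k\<in>K. - form k ?x) = 0" using k finite_K by auto
      with eq[of ?x] t show False by auto
    qed
    note van = this
    have "a = a'" if "a \<in> A" "a' \<in> A" for a a'
      by (rule cofactor_single_term[where c = c' and c' = c, OF B(1) A _ k van that])
        (simp_all add: eq mult.commute[of "sum_eval B c' _"])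
    then show ?thesis by blast
  qed
qed

end

subsection \<open>Determinants over a finite index set\<close>

lemma det_on_cong:
  assumes "\<And>m w. m \<in> W \<Longrightarrow> w \<in> W \<Longrightarrow> M m w = M' m w"
  shows "det_on W M = det_on W M'"
  unfolding det_on_def
proof (intro sum.cong refl arg_cong2[where f = "(*)"] prod.cong)
  fix p m assume "p \<in> {p. p permutes W}" "m \<in> W"
  then show "M m (p m) = M' m (p m)" using assms by (simp add: permutes_in_image)
qed

text \<open>Transporting permutations along the enumeration \<open>b\<close> preserves signs. This
  bridge to matrices makes multiplicativity of \<open>det\<close> available for
  \<open>det_on\<close>.\<close>

lemma det_on_eq_det:
  assumes b: "bij_betw b {0..<n} W"
  shows "det_on W M = det (mat n n (\<lambda>(i, j). M (b i) (b j)))"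
proof -
  let ?N = "{0..<n}"
  have inj: "inj_on b ?N" and img: "b ` ?N = W" using b by (auto simp: bij_betw_def)
  have b': "bij_betw (inv_into ?N b) W ?N" using b by (rule bij_betw_inv_into)
  have "(\<Sum>p\<in>{p. p permutes ?N}. of_int (sign p) * (\<Prod>i\<in>?N. M (b i) (b (p i)))) =
      (\<Sum>p\<in>{p. p permutes W}. of_int (sign p) * (\<Prod>m\<in>W. M m (p m)))"
  proof (rule sum.reindex_bij_witness[of _ "map_permutation W (inv_into ?N b)" "map_permutation ?N b"])
    fix p assume "p \<in> {p. p permutes ?N}"
    then have p: "p permutes ?N" by simp
    show "map_permutation ?N b p \<in> {p. p permutes W}" using map_permutation_permutes[OF b p] by simp
    show "map_permutation W (inv_into ?N b) (map_permutation ?N b p) = p"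
      by (rule map_permutation_compose_inv[OF b p]) (use inj in auto)
    have "(\<Prod>m\<in>W. M m (map_permutation ?N b p m)) = (\<Prod>i\<in>?N. M (b i) (b (p i)))"
      unfolding prod.reindex_bij_betw[OF b, symmetric]
      by (intro prod.cong refl) (simp add: map_permutation_apply[OF inj])
    then show "of_int (sign (map_permutation ?N b p)) * (\<Prod>m\<in>W. M m (map_permutation ?N b p m)) =
        of_int (sign p) * (\<Prod>i\<in>?N. M (b i) (b (p i)))"
      by (simp add: sign_map_permutation[OF inj p])
  next
    fix p assume "p \<in> {p. p permutes W}"
    then have p: "p permutes W" by simp
    show "map_permutation W (inv_into ?N b) p \<in> {p. p permutes ?N}"
      using map_permutation_permutes[OF b' p] by simp
    show "map_permutation ?N b (map_permutation W (inv_into ?N b) p) = p"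
      by (rule map_permutation_compose_inv[OF b' p]) (rule bij_betw_inv_into_right[OF b])
  qed
  moreover have "(\<Prod>i\<in>?N. mat n n (\<lambda>(i, j). M (b i) (b j)) $$ (i, p i)) = (\<Prod>i\<in>?N. M (b i) (b (p i)))"
    if "p permutes ?N" for p
  proof (intro prod.cong refl)
    fix i assume "i \<in> ?N"
    then have "p i \<in> ?N" using permutes_in_image[OF that] by blast
    with \<open>i \<in> ?N\<close> show "mat n n (\<lambda>(i, j). M (b i) (b j)) $$ (i, p i) = M (b i) (b (p i))" by simp
  qed
  ultimately show ?thesis by (simp add: det_on_def det_def)
qed

lemma det_on_mult:
  fixes A B :: "'a \<Rightarrow> 'a \<Rightarrow> 'r::comm_ring_1"
  assumes "finite W"
  shows "det_on W (\<lambda>m w. \<Sum>v\<in>W. A m v * B v w) = det_on W A * det_on W B"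
proof -
  obtain b where b: "bij_betw b {0..<card W} W" using ex_bij_betw_nat_finite[OF assms] by blast
  let ?n = "card W"
  let ?mat = "\<lambda>M :: 'a \<Rightarrow> 'a \<Rightarrow> 'r. mat ?n ?n (\<lambda>(i, j). M (b i) (b j))"
  have "?mat (\<lambda>m w. \<Sum>v\<in>W. A m v * B v w) = ?mat A * ?mat B"
    by (rule eq_matI) (auto simp: scalar_prod_def sum.reindex_bij_betw[OF b, symmetric])
  then show ?thesis
    by (simp only: det_on_eq_det[OF b]) (rule det_mult[where n = ?n], auto)
qed

lemma det_on_diag:
  assumes "finite W"
  shows "det_on W (\<lambda>m w. if m = w then d m else 0) = prod d W"
proof -
  have "of_int (sign p) * (\<Prod>m\<in>W. if m = p m then d m else 0) = (if p = id then prod d W else 0)"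
    if "p permutes W" for p
  proof (cases "p = id")
    case False
    then obtain m where "p m \<noteq> m" by (metis eq_id_iff)
    then have "m \<in> W" using permutes_not_in[OF that] by metis
    then have "(\<Prod>m\<in>W. if m = p m then d m else 0) = 0"
      using \<open>p m \<noteq> m\<close> by (intro prod_zero[OF assms]) force
    with False show ?thesis by simp
  qed simp
  then have "det_on W (\<lambda>m w. if m = w then d m else 0) =
      (\<Sum>p\<in>{p. p permutes W}. if p = id then prod d W else 0)"
    unfolding det_on_def by (intro sum.cong) auto
  also have "\<dots> = prod d W" using finite_permutations[OF assms] by (simp add: permutes_id)
  finally show ?thesis .
qed

text \<open>Conjugation by a diagonal matrix: along a permutation the elements \<open>g m\<close>
  and \<open>g (p m)\<close> have the same product and cancel.\<close>

lemma det_on_gauge: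
  fixes M :: "'a \<Rightarrow> 'a \<Rightarrow> 'r::field"
  assumes "\<And>m. m \<in> W \<Longrightarrow> g m \<noteq> 0" "finite W"
  shows "det_on W (\<lambda>m w. g m / g w * M m w) = det_on W M"
  unfolding det_on_def
proof (intro sum.cong refl arg_cong2[where f = "(*)"])
  fix p assume "p \<in> {p. p permutes W}"
  then have "(\<Prod>m\<in>W. g (p m)) = (\<Prod>m\<in>W. g m)"
    using prod.permute[of p W g] by (simp add: o_def)
  moreover have "(\<Prod>m\<in>W. g m) \<noteq> 0" using assms by simp
  ultimately show "(\<Prod>m\<in>W. g m / g (p m) * M m (p m)) = (\<Prod>m\<in>W. M m (p m))"
    by (simp add: prod.distrib prod_dividef)
qed

lemma det_on_smult:
  "det_on W (\<lambda>m w. c * M m w) = c ^ card W * det_on W M"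
  by (simp add: det_on_def prod.distrib sum_distrib_left mult_ac)

text \<open>The determinant is a polynomial in its entries, so a leading part can be computed entry
  by entry.\<close>

lemma det_on_tendsto:
  fixes M :: "'a \<Rightarrow> 'a \<Rightarrow> 'b \<Rightarrow> 'r::{comm_ring_1, real_normed_algebra_1}"
  assumes "\<And>m w. m \<in> W \<Longrightarrow> w \<in> W \<Longrightarrow> (M m w \<longlongrightarrow> L m w) F"
  shows "((\<lambda>n. det_on W (\<lambda>m w. M m w n)) \<longlongrightarrow> det_on W L) F"
  unfolding det_on_def
proof (intro tendsto_sum tendsto_mult tendsto_const tendsto_prod)
  fix p m assume "p \<in> {p. p permutes W}" "m \<in> W"
  then show "(M m (p m) \<longlongrightarrow> L m (p m)) F" using assms by (simp add: permutes_in_image)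
qed

text \<open>The columns of \<open>F\<close> are eigenvectors, so \<open>T\<close> times
  \<open>F\<close> equals \<open>F\<close> times the diagonal matrix of \<open>l\<close>; the
  determinant of \<open>F\<close> cancels.\<close>

lemma det_on_eigenbasis:
  fixes T F :: "'a \<Rightarrow> 'a \<Rightarrow> 'r::idom"
  assumes W: "finite W" and F: "det_on W F \<noteq> 0"
    and eig: "\<And>m k. m \<in> W \<Longrightarrow> k \<in> W \<Longrightarrow> (\<Sum>v\<in>W. T m v * F v k) = l k * F m k"
  shows "det_on W T = prod l W"
proof -
  have "det_on W T * det_on W F = det_on W (\<lambda>m k. l k * F m k)"
    by (subst det_on_mult[OF W, symmetric]) (rule det_on_cong, simp add: eig)
  also have "\<dots> = det_on W (\<lambda>m k. \<Sum>v\<in>W. F m v * (if v = k then l v else 0))"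
    by (rule det_on_cong) (simp add: W if_distrib[of "(*) _"] mult.commute cong: if_cong)
  also have "\<dots> = det_on W F * prod l W" by (simp add: det_on_mult[OF W] det_on_diag[OF W])
  finally show ?thesis using F by simp
qed

subsection \<open>Leading parts of the Floquet determinant\<close>

definition unity_root :: "nat \<Rightarrow> int \<Rightarrow> complex" where
  "unity_root q i = cis (2 * pi * of_int i / of_nat q)"

lemma unity_root_nonzero [simp]: "unity_root q i \<noteq> 0"
  by (simp add: unity_root_def)

lemma unity_root_add: "unity_root q (i + j) = unity_root q i * unity_root q j"
  by (simp add: unity_root_def cis_mult ring_distribs add_divide_distrib)

lemma unity_root_powi: "unity_root q i powi j = unity_root q (i * j)"
  by (simp add: unity_root_def cis_power_int mult_ac)

lemma unity_root_eq_1_iff: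
  assumes "q > 0"
  shows "unity_root q i = 1 \<longleftrightarrow> int q dvd i"
proof
  assume "unity_root q i = 1"
  then have "cos (2 * pi * of_int i / of_nat q) = 1" by (simp add: unity_root_def complex_eq_iff)
  then obtain n :: int where "2 * pi * of_int i / of_nat q = of_int n * 2 * pi" using cos_one_2pi_int by blast
  then have "real_of_int i = real_of_int (n * int q)" using assms by (simp add: field_simps)
  then have "i = n * int q" by (simp only: of_int_eq_iff)
  then show "int q dvd i" by simp
next
  assume "int q dvd i"
  then obtain n where "i = int q * n" by blast
  then have "2 * pi * of_int i / of_nat q = 2 * pi * real_of_int n" using assms by simp
  then show "unity_root q i = 1" by (simp add: unity_root_def del: of_int_mult)
qed

lemma unity_root_mod:
  assumes "q > 0"
  shows "unity_root q (k * (n mod int q)) = unity_root q (k * n)"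
proof -
  have "k * n = k * (n mod int q) + int q * (k * (n div int q))"
    by (metis add.commute distrib_left mult.left_commute mult_div_mod_eq)
  then have "unity_root q (k * n) = unity_root q (k * (n mod int q)) * unity_root q (int q * (k * (n div int q)))"
    by (simp only: unity_root_add)
  then show ?thesis using unity_root_eq_1_iff[OF assms, of "int q * (k * (n div int q))"] by simp
qed

text \<open>A geometric sum in \<open>unity_root q i\<close>; this is character orthogonality for
  the cyclic group of order \<open>q\<close>.\<close>

lemma sum_unity_root:
  assumes q: "q > 0"
  shows "(\<Sum>v\<in>{0..<int q}. unity_root q (v * i)) = (if int q dvd i then of_nat q else 0)"
proof -
  have "(\<Sum>v\<in>{0..<int q}. unity_root q (v * i)) = (\<Sum>v\<in>int ` {0..<q}. unity_root q (v * i))"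
    by (simp add: image_int_atLeastLessThan)
  also have "\<dots> = (\<Sum>v<q. unity_root q i ^ v)"
  proof (subst sum.reindex)
    have "unity_root q (int v * i) = unity_root q i ^ v" for v
      using unity_root_powi[of q i "int v"] by (simp add: mult.commute)
    then show "sum ((\<lambda>v. unity_root q (v * i)) \<circ> int) {0..<q} = (\<Sum>v<q. unity_root q i ^ v)"
      by (simp add: lessThan_atLeast0)
  qed simp
  finally have eq: "(\<Sum>v\<in>{0..<int q}. unity_root q (v * i)) = (\<Sum>v<q. unity_root q i ^ v)" .
  show ?thesis
  proof (cases "int q dvd i")
    case True
    then have "unity_root q i = 1" using unity_root_eq_1_iff[OF q] by blast
    with True eq show ?thesis by simp
  next
    case False
    then have "unity_root q i \<noteq> 1" using unity_root_eq_1_iff[OF q] by blast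
    moreover have "unity_root q i ^ q = 1"
      using unity_root_powi[of q i "int q"] unity_root_eq_1_iff[OF q, of "i * int q"] by simp
    ultimately show ?thesis using False eq by (simp add: sum_gp_strict)
  qed
qed

lemma fund_domain_PiE: "fund_domain q = PiE UNIV (\<lambda>j. {0..<int (q j)})"
  by (auto simp: fund_domain_def PiE_def)

lemma finite_fund_domain: "finite (fund_domain (q :: 'd::finite \<Rightarrow> nat))"
  unfolding fund_domain_PiE by (intro finite_PiE) auto

lemma card_fund_domain: "card (fund_domain (q :: 'd::finite \<Rightarrow> nat)) = (\<Prod>j\<in>UNIV. q j)"
  unfolding fund_domain_PiE by (simp add: card_PiE)

lemma red_pt_in_fund_domain: "(\<And>j. q j > 0) \<Longrightarrow> red_pt q n \<in> fund_domain q"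
  by (simp add: red_pt_def fund_domain_def)

definition fourier :: "('d::finite \<Rightarrow> nat) \<Rightarrow> ('d \<Rightarrow> int) \<Rightarrow> ('d \<Rightarrow> int) \<Rightarrow> complex" where
  "fourier q m k = (\<Prod>j\<in>UNIV. unity_root (q j) (k j * m j))"

lemma fourier_red_pt:
  assumes "\<And>j. q j > 0"
  shows "fourier q (red_pt q m) k = fourier q m k"
  by (simp add: fourier_def red_pt_def unity_root_mod assms)

lemma fourier_shift:
  "fourier q (m(j := m j + s)) k = unity_root (q j) (s * k j) * fourier q m k"
proof -
  have "fourier q (m(j := m j + s)) k =
      (\<Prod>i\<in>UNIV. (if i = j then unity_root (q j) (s * k j) else 1) * unity_root (q i) (k i * m i))"
    unfolding fourier_def
    by (intro prod.cong refl) (auto simp: algebra_simps unity_root_add)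
  then show ?thesis by (simp add: prod.distrib fourier_def)
qed

text \<open>By orthogonality, multiplication by the matrix of inverse characters gives the product
  of all \<open>q j\<close> times the identity.\<close>

lemma det_fourier_nonzero:
  fixes q :: "'d::finite \<Rightarrow> nat"
  assumes q: "\<And>j. q j > 0"
  shows "det_on (fund_domain q) (fourier q) \<noteq> 0"
proof -
  let ?W = "fund_domain q"
  let ?Q = "(\<Prod>j\<in>UNIV. of_nat (q j)) :: complex"
  have orth: "(\<Sum>v\<in>?W. fourier q m v * fourier q (\<lambda>j. - w j) v) = (if m = w then ?Q else 0)"
    if "m \<in> ?W" "w \<in> ?W" for m w
  proof -
    have "(\<Sum>v\<in>?W. fourier q m v * fourier q (\<lambda>j. - w j) v) =
        (\<Sum>v\<in>?W. \<Prod>j\<in>UNIV. unity_root (q j) (v j * (m j - w j)))"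
      by (simp add: fourier_def algebra_simps flip: prod.distrib unity_root_add)
    also have "\<dots> = (\<Prod>j\<in>UNIV. \<Sum>v\<in>{0..<int (q j)}. unity_root (q j) (v * (m j - w j)))"
      unfolding fund_domain_PiE by (subst prod_sum_PiE) auto
    also have "\<dots> = (\<Prod>j\<in>UNIV. if m j = w j then of_nat (q j) else 0)"
    proof (intro prod.cong refl)
      fix j
      have "0 \<le> m j" "m j < int (q j)" "0 \<le> w j" "w j < int (q j)" using that by (auto simp: fund_domain_def)
      then have "int (q j) dvd m j - w j \<longleftrightarrow> m j = w j"
        by (metis diff_self dvd_0_right mod_eq_dvd_iff mod_pos_pos_trivial)
      then show "(\<Sum>v\<in>{0..<int (q j)}. unity_root (q j) (v * (m j - w j))) = (if m j = w j then of_nat (q j) else 0)"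
        by (simp add: sum_unity_root[OF q])
    qed
    also have "\<dots> = (if m = w then ?Q else 0)"
      by (auto simp: fun_eq_iff)
    finally show ?thesis .
  qed
  have "det_on ?W (fourier q) * det_on ?W (\<lambda>v w. fourier q (\<lambda>j. - w j) v) =
      det_on ?W (\<lambda>m w. \<Sum>v\<in>?W. fourier q m v * fourier q (\<lambda>j. - w j) v)"
    by (rule det_on_mult[OF finite_fund_domain, symmetric])
  also have "\<dots> = det_on ?W (\<lambda>m w. if m = w then ?Q else 0)"
    by (rule det_on_cong) (rule orth)
  also have "\<dots> = (\<Prod>m\<in>?W. ?Q)" by (rule det_on_diag[OF finite_fund_domain])
  also have "\<dots> \<noteq> 0" using q by simp
  finally show ?thesis by auto
qed

text \<open>The columns of \<open>fourier q\<close> are common eigenvectors of all periodic shifts: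
  on column \<open>k\<close>, the shift by \<open>w j\<close> in direction \<open>j\<close> has
  eigenvalue \<open>unity_root (q j) (w j * k j)\<close>.\<close>

lemma det_on_shift:
  fixes q :: "'d::finite \<Rightarrow> nat" and w :: "'d \<Rightarrow> int" and y :: "'d \<Rightarrow> complex"
  assumes q: "\<And>j. q j > 0"
  shows "det_on (fund_domain q)
      (\<lambda>m v. - (\<Sum>j\<in>J. if red_pt q (m(j := m j + w j)) = v then y j else 0)) =
    (\<Prod>k\<in>fund_domain q. - (\<Sum>j\<in>J. unity_root (q j) (w j * k j) * y j))"
proof (rule det_on_eigenbasis[OF finite_fund_domain det_fourier_nonzero[OF q]])
  fix m k assume "m \<in> fund_domain q" "k \<in> fund_domain q"
  let ?W = "fund_domain q" and ?n = "\<lambda>j. red_pt q (m(j := m j + w j))"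
  have "(\<Sum>v\<in>?W. (\<Sum>j\<in>J. if ?n j = v then y j else 0) * fourier q v k) =
      (\<Sum>j\<in>J. \<Sum>v\<in>?W. if ?n j = v then y j * fourier q v k else 0)"
    unfolding sum_distrib_right by (subst sum.swap) (intro sum.cong refl, simp)
  also have "\<dots> = (\<Sum>j\<in>J. y j * fourier q (?n j) k)"
    by (simp add: finite_fund_domain red_pt_in_fund_domain[OF q])
  also have "\<dots> = (\<Sum>j\<in>J. unity_root (q j) (w j * k j) * y j) * fourier q m k"
    unfolding fourier_red_pt[OF q] fourier_shift sum_distrib_right
    by (intro sum.cong refl) (simp add: mult_ac)
  finally show "(\<Sum>v\<in>?W. - (\<Sum>j\<in>J. if ?n j = v then y j else 0) * fourier q v k) =
      - (\<Sum>j\<in>J. unity_root (q j) (w j * k j) * y j) * fourier q m k"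
    by (simp add: sum_negf)
qed

section \<open>Entries of the Floquet matrix and their scaling limits\<close>

lemma neighbours_bij:
  fixes m :: "'d::finite \<Rightarrow> int"
  shows "bij_betw (\<lambda>(j, s). m(j := m j + s)) (UNIV \<times> {1, -1}) {n. (\<Sum>j\<in>UNIV. \<bar>n j - m j\<bar>) = 1}"
  unfolding bij_betw_def
proof
  show "inj_on (\<lambda>(j, s). m(j := m j + s)) (UNIV \<times> {1, -1})"
  proof (rule inj_onI, clarify)
    fix j s j' s' assume s: "s \<in> {1, -1}" "s' \<in> {1, -1 :: int}" and eq: "m(j := m j + s) = m(j' := m j' + s')"
    from fun_cong[OF eq, of j] fun_cong[OF eq, of j'] s show "j = j' \<and> s = s'"
      by (auto split: if_splits)
  qed
  show "(\<lambda>(j, s). m(j := m j + s)) ` (UNIV \<times> {1, -1}) = {n. (\<Sum>j\<in>UNIV. \<bar>n j - m j\<bar>) = 1}"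
  proof (intro equalityI subsetI)
    fix n assume "n \<in> (\<lambda>(j, s). m(j := m j + s)) ` (UNIV \<times> {1, -1})"
    then obtain p where p: "n = (\<lambda>(j, s). m(j := m j + s)) p" "p \<in> UNIV \<times> {1, -1}" by (rule imageE)
    obtain j s where "p = (j, s)" by (cases p)
    with p have n: "n = m(j := m j + s)" "s \<in> {1, -1}" by simp_all
    have "(\<Sum>i\<in>UNIV. \<bar>n i - m i\<bar>) = (\<Sum>i\<in>UNIV. if i = j then \<bar>s\<bar> else 0)"
      by (rule sum.cong) (auto simp: n)
    then show "n \<in> {n. (\<Sum>j\<in>UNIV. \<bar>n j - m j\<bar>) = 1}" using n by auto
  next
    fix n assume "n \<in> {n. (\<Sum>j\<in>UNIV. \<bar>n j - m j\<bar>) = 1}"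
    then have n: "(\<Sum>j\<in>UNIV. \<bar>n j - m j\<bar>) = 1" by simp
    then obtain j where j: "\<bar>n j - m j\<bar> \<noteq> 0" by (metis sum.neutral zero_neq_one)
    have split: "\<bar>n j - m j\<bar> + (\<Sum>i\<in>UNIV-{j}. \<bar>n i - m i\<bar>) = 1"
      using n by (subst sum.remove[symmetric]) auto
    moreover have "(\<Sum>i\<in>UNIV-{j}. \<bar>n i - m i\<bar>) \<ge> 0" by (intro sum_nonneg) auto
    ultimately have "(\<Sum>i\<in>UNIV-{j}. \<bar>n i - m i\<bar>) = 0" and s: "\<bar>n j - m j\<bar> = 1" using j by linarith+
    then have "\<forall>i\<in>UNIV-{j}. \<bar>n i - m i\<bar> = 0" by (subst (asm) sum_nonneg_eq_0_iff) auto
    then have n': "n = m(j := m j + (n j - m j))" by (auto simp: fun_eq_iff)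
    have s': "n j - m j \<in> {1, -1}" using s by auto
    show "n \<in> (\<lambda>(j, s). m(j := m j + s)) ` (UNIV \<times> {1, -1})"
    proof (rule image_eqI)
      show "n = (\<lambda>(j, s). m(j := m j + s)) (j, n j - m j)" unfolding prod.case by (rule n')
      show "(j, n j - m j) \<in> UNIV \<times> {1, -1}" using s' by blast
    qed
  qed
qed

text \<open>In the gauge \<open>u n = X\<^sup>n * v n\<close> (so that \<open>z\<^sub>j = X\<^sub>j ^ q\<^sub>j\<close>) a hop in direction \<open>s e\<^sub>j\<close>
  contributes \<open>X\<^sub>j\<^sup>s\<close>, irrespective of whether it leaves the fundamental domain.\<close>

lemma laurent_eval_floquet_entry:
  fixes q :: "'d::finite \<Rightarrow> nat"
  assumes X: "X \<in> torus"
  defines "g \<equiv> \<lambda>n. \<Prod>j\<in>UNIV. X j powi n j"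
  shows "laurent_eval (floquet_entry q V lam m v) (coord_powi (\<lambda>j. int (q j)) X) =
    g m / g v * ((if m = v then V m - lam else 0) -
      (\<Sum>j\<in>UNIV. \<Sum>s\<in>{1, -1}. if red_pt q (m(j := m j + s)) = v then X j powi s else 0))"
proof -
  let ?z = "coord_powi (\<lambda>j. int (q j)) X"
  have Xnz: "X j \<noteq> 0" for j using X by (simp add: torus_def)
  have g: "g n \<noteq> 0" for n using Xnz by (simp add: g_def)
  \<comment> \<open>Since \<open>z j = X j ^ q j\<close>, division with remainder turns the Floquet
    multiplier of \<open>n\<close> into the ratio of the gauge factors at \<open>n\<close> and at
    its reduction.\<close>
  have quot: "mono_eval (quot_pt q n) ?z = g n / g (red_pt q n)" for n
  proof -
    have "Poly_Mapping.lookup (quot_pt q n) j = n j div int (q j)" for j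
      by (simp add: quot_pt_def)
    moreover have "(X j powi int (q j)) powi (n j div int (q j)) = X j powi n j / X j powi (n j mod int (q j))" for j
    proof -
      have "(X j powi int (q j)) powi (n j div int (q j)) = X j powi (n j - n j mod int (q j))"
        by (simp only: power_int_mult[symmetric] minus_mod_eq_mult_div)
      then show ?thesis by (simp only: power_int_diff[OF disjI1[OF Xnz]])
    qed
    ultimately show ?thesis
      by (simp add: mono_eval_def coord_powi_def g_def red_pt_def prod_dividef del: power_int_of_nat)
  qed
  have shift: "g (m(j := m j + s)) = g m * X j powi s" for j s
  proof -
    have "g (m(j := m j + s)) = (\<Prod>i\<in>UNIV. X i powi m i * (if i = j then X j powi s else 1))"
      unfolding g_def by (intro prod.cong) (auto simp: power_int_add Xnz)
    then show ?thesis by (simp add: prod.distrib g_def)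
  qed
  have "laurent_eval (floquet_entry q V lam m v) ?z =
      (if m = v then V m - lam else 0) -
      (\<Sum>n\<in>{n. (\<Sum>j\<in>UNIV. \<bar>n j - m j\<bar>) = 1}. if red_pt q n = v then g n / g v else 0)"
    unfolding floquet_entry_def laurent_eval_diff laurent_eval_sum
    by (intro arg_cong2[where f = "(-)"] sum.cong refl)
       (auto simp: laurent_const_def laurent_eval_single quot)
  also have "(\<Sum>n\<in>{n. (\<Sum>j\<in>UNIV. \<bar>n j - m j\<bar>) = 1}. if red_pt q n = v then g n / g v else 0) =
      (\<Sum>(j, s)\<in>UNIV \<times> {1, -1}. if red_pt q (m(j := m j + s)) = v then g m * X j powi s / g v else 0)"
    by (subst sum.reindex_bij_betw[OF neighbours_bij, symmetric])
       (intro sum.cong refl, simp only: case_prod_unfold shift)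
  also have "\<dots> = g m / g v *
      (\<Sum>j\<in>UNIV. \<Sum>s\<in>{1, -1}. if red_pt q (m(j := m j + s)) = v then X j powi s else 0)"
    unfolding sum.cartesian_product[symmetric] sum_distrib_left
    by (intro sum.cong refl) auto
  also have "(if m = v then V m - lam else 0) = g m / g v * (if m = v then V m - lam else 0)"
    using g by simp
  finally show ?thesis by (simp only: right_diff_distrib)
qed

text \<open>After the gauge, entries grow at most like \<open>t = Suc n\<close>. Dividing each row
  by \<open>t\<close> uses up the normalizing power of \<open>t\<close> and kills the potential,
  \<open>lam\<close> and every hop except those with \<open>w j * s = 1\<close>;
  \<open>det_on_shift\<close> evaluates what survives.\<close>

lemma floquet_scaling_limit:
  fixes q :: "'d::finite \<Rightarrow> nat" and w :: "'d \<Rightarrow> int"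
  assumes q: "\<And>j. q j > 0" and x: "x \<in> torus" and w: "\<And>j. w j \<in> {-1, 0, 1}"
  shows "(\<lambda>n. laurent_eval (floquet_poly q V lam)
        (coord_powi (\<lambda>j. int (q j)) (\<lambda>j. x j * of_nat (Suc n) powi w j))
      * of_nat (Suc n) powi (- int (card (fund_domain q))))
    \<longlonglongrightarrow> (\<Prod>k\<in>fund_domain q. - (\<Sum>j\<in>{j. w j \<noteq> 0}. unity_root (q j) (w j * k j) * x j powi w j))"
proof -
  let ?W = "fund_domain q" and ?t = "\<lambda>n. complex_of_nat (Suc n)"
  let ?X = "\<lambda>n j. x j * ?t n powi w j"
  define M where "M m v n = (if m = v then V m - lam else 0) -
      (\<Sum>j\<in>UNIV. \<Sum>s\<in>{1, -1}. if red_pt q (m(j := m j + s)) = v then ?X n j powi s else 0)" for m v n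
  have tnz: "?t n \<noteq> 0" for n by (rule of_nat_neq_0)
  have eval: "laurent_eval (floquet_poly q V lam) (coord_powi (\<lambda>j. int (q j)) (?X n))
      * ?t n powi (- int (card ?W)) = det_on ?W (\<lambda>m v. ?t n powi (-1) * M m v n)" for n
  proof -
    have X: "?X n \<in> torus" using x tnz by (simp add: torus_def del: of_nat_Suc)
    let ?z = "coord_powi (\<lambda>j. int (q j)) (?X n)"
    let ?g = "\<lambda>m. \<Prod>j\<in>UNIV. ?X n j powi m j"
    have "laurent_eval (floquet_poly q V lam) ?z =
        det_on ?W (\<lambda>m v. laurent_eval (floquet_entry q V lam m v) ?z)"
      using coord_powi_torus[OF X, of "\<lambda>j. int (q j)"]
      by (simp add: floquet_poly_def det_on_def laurent_eval_sum laurent_eval_mult laurent_eval_prod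
          laurent_eval_of_int del: of_nat_Suc)
    also have "\<dots> = det_on ?W (\<lambda>m v. ?g m / ?g v * M m v n)"
      unfolding M_def by (rule det_on_cong) (rule laurent_eval_floquet_entry[OF X])
    also have "\<dots> = det_on ?W (\<lambda>m v. M m v n)"
      by (rule det_on_gauge) (use X in \<open>auto simp: torus_def finite_fund_domain\<close>)
    finally show ?thesis
      by (simp only: det_on_smult power_int_minus power_int_1_right power_int_of_nat power_inverse mult.commute)
  qed
  have lim: "(\<lambda>n. ?t n powi (-1) * M m v n) \<longlonglongrightarrow>
      - (\<Sum>j\<in>{j. w j \<noteq> 0}. if red_pt q (m(j := m j + w j)) = v then x j powi w j else 0)" for m v
  proof -
    \<comment> \<open>The limit of a single hop: after division its power of \<open>t\<close> is
      \<open>w j * s - 1\<close>, which is 0 or negative.\<close>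
    define h where "h j s = (if red_pt q (m(j := m j + s)) = v \<and> w j * s = 1 then x j powi s else 0)" for j s
    have hop: "(\<lambda>n. ?t n powi (-1) * (if red_pt q (m(j := m j + s)) = v then ?X n j powi s else 0)) \<longlonglongrightarrow> h j s"
      if s: "s \<in> {1, -1}" for j s
    proof (cases "red_pt q (m(j := m j + s)) = v")
      case True
      have "?t n powi (-1) * ?X n j powi s = x j powi s * ?t n powi (w j * s - 1)" for n
      proof -
        have "?t n powi (w j * s - 1) = ?t n powi (w j * s) * ?t n powi (-1)"
          using power_int_add[OF disjI1[OF tnz], of n "w j * s" "-1"] by (simp del: of_nat_Suc)
        then show ?thesis by (simp only: power_int_mult_distrib power_int_mult[of "?t n" "w j" s, symmetric] mult.commute mult.left_commute)
      qed
      moreover have "(\<lambda>n. x j powi s * ?t n powi (w j * s - 1)) \<longlonglongrightarrow> h j s"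
      proof (cases "w j * s = 1")
        case False
        then have "w j * s - 1 < 0" using w[of j] s by auto
        from tendsto_mult_right_zero[OF of_nat_powi_tendsto_0[OF this], of "x j powi s"] False
        show ?thesis by (simp add: h_def del: of_nat_Suc)
      qed (use True in \<open>simp add: h_def\<close>)
      ultimately show ?thesis using True by (simp del: of_nat_Suc)
    qed (simp add: h_def)
    have "(\<lambda>n. ?t n powi (-1) * (if m = v then V m - lam else 0) -
        (\<Sum>j\<in>UNIV. \<Sum>s\<in>{1, -1}. ?t n powi (-1) * (if red_pt q (m(j := m j + s)) = v then ?X n j powi s else 0)))
        \<longlonglongrightarrow> 0 - (\<Sum>j\<in>UNIV. \<Sum>s\<in>{1, -1}. h j s)"
      by (intro tendsto_diff tendsto_sum tendsto_mult_left_zero of_nat_powi_tendsto_0 hop) auto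
    also have "(\<Sum>j\<in>UNIV. \<Sum>s\<in>{1, -1}. h j s) =
        (\<Sum>j\<in>UNIV. if w j \<noteq> 0 then if red_pt q (m(j := m j + w j)) = v then x j powi w j else 0 else 0)"
    proof (rule sum.cong)
      fix j
      consider "w j = -1" | "w j = 0" | "w j = 1" using w[of j] by auto
      then show "(\<Sum>s\<in>{1, -1}. h j s) =
          (if w j \<noteq> 0 then if red_pt q (m(j := m j + w j)) = v then x j powi w j else 0 else 0)"
        by cases (auto simp: h_def)
    qed simp
    also have "\<dots> = (\<Sum>j\<in>{j. w j \<noteq> 0}. if red_pt q (m(j := m j + w j)) = v then x j powi w j else 0)"
      by (simp add: sum.inter_filter[of UNIV, simplified])
    finally show ?thesis
      by (simp only: M_def right_diff_distrib sum_distrib_left diff_0)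
  qed
  show ?thesis
    unfolding eval det_on_shift[OF q, symmetric] by (rule det_on_tendsto) (rule lim)
qed

subsection \<open>Factorizations\<close>

text \<open>The least positive \<open>r\<close> with \<open>s ^ r = 1\<close> divides every
  \<open>q j\<close>, by division with remainder, and hence their gcd.\<close>

lemma eq_1_if_coprime_powers:
  fixes s :: "'a::comm_monoid_mult"
  assumes q: "\<And>j. q j > 0" and Gcd: "Gcd (range q) = (1::nat)" and s: "\<And>j. s ^ q j = 1"
  shows "s = 1"
proof -
  define r where "r = (LEAST n. n > 0 \<and> s ^ n = 1)"
  have r: "r > 0 \<and> s ^ r = 1"
    unfolding r_def by (rule LeastI[of _ "q undefined"]) (simp add: q s)
  have "r dvd q j" for j
  proof (rule ccontr)
    assume "\<not> r dvd q j"
    then have pos: "q j mod r > 0" by (simp add: dvd_eq_mod_eq_0)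
    have "s ^ q j = (s ^ r) ^ (q j div r) * s ^ (q j mod r)"
      by (simp flip: power_mult power_add)
    then have "s ^ (q j mod r) = 1" using r s by simp
    then have "r \<le> q j mod r" unfolding r_def by (intro Least_le) (use pos r_def in auto)
    moreover have "q j mod r < r" using r by simp
    ultimately show False by simp
  qed
  then have "r dvd Gcd (range q)" by (auto intro: Gcd_greatest)
  then show ?thesis using r Gcd by simp
qed

text \<open>A common ratio \<open>s\<close> of the coefficients would be a \<open>q j\<close>-th
  root of unity for every \<open>j\<close> at once, hence 1; then \<open>k\<close> and
  \<open>k'\<close> agree modulo every \<open>q j\<close> and coincide in the fundamental domain.
  This is where the gcd hypothesis enters.\<close>

lemma unity_roots_not_proportional:
  fixes q :: "'d::finite \<Rightarrow> nat"
  assumes q: "\<And>j. q j > 0" and Gcd: "Gcd (range q) = 1" and w: "\<And>j. w j \<in> {1, -1}"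
    and k: "k \<in> fund_domain q" "k' \<in> fund_domain q" "k \<noteq> k'"
  shows "\<exists>j. unity_root (q j) (w j * k j) \<noteq> s * unity_root (q j) (w j * k' j)"
proof (rule ccontr)
  assume "\<not> ?thesis"
  then have eq: "unity_root (q j) (w j * k j) = s * unity_root (q j) (w j * k' j)" for j by blast
  have s: "s = unity_root (q j) (w j * (k j - k' j))" for j
  proof -
    have "unity_root (q j) (w j * k j) = unity_root (q j) (w j * (k j - k' j)) * unity_root (q j) (w j * k' j)"
      by (simp add: algebra_simps flip: unity_root_add)
    with eq[of j] show ?thesis by simp
  qed
  have "s ^ q j = 1" for j
    using unity_root_powi[of "q j" "w j * (k j - k' j)" "int (q j)"]
      unity_root_eq_1_iff[OF q, of j "w j * (k j - k' j) * int (q j)"] by (simp add: s[of j])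
  then have "s = 1" using eq_1_if_coprime_powers[OF q Gcd] by blast
  then have dvd: "int (q j) dvd w j * (k j - k' j)" for j
    using s[of j] unity_root_eq_1_iff[OF q] by metis
  have "k j = k' j" for j
  proof -
    have "int (q j) dvd k j - k' j" using dvd[of j] w[of j] by (auto simp: dvd_diff_commute)
    moreover have "0 \<le> k j" "k j < int (q j)" "0 \<le> k' j" "k' j < int (q j)"
      using k by (auto simp: fund_domain_def)
    ultimately show ?thesis by (metis mod_eq_dvd_iff mod_pos_pos_trivial)
  qed
  with k show False by (auto simp: fun_eq_iff)
qed

text \<open>The support function of the Newton polytope in direction \<open>v\<close>;
  \<open>top_keys\<close> then collects the exponents on the corresponding face. \<open>Max\<close>
  is meaningful only for nonzero \<open>f\<close>.\<close>

definition top_degree :: "('d::finite \<Rightarrow> int) \<Rightarrow> 'd laurent \<Rightarrow> int" where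
  "top_degree v f = Max (weight v ` Poly_Mapping.keys f)"

definition top_keys :: "('d::finite \<Rightarrow> int) \<Rightarrow> 'd laurent \<Rightarrow> ('d \<Rightarrow>\<^sub>0 int) set" where
  "top_keys v f = {a \<in> Poly_Mapping.keys f. weight v a = top_degree v f}"

lemma weight_le_top_degree: "a \<in> Poly_Mapping.keys f \<Longrightarrow> weight v a \<le> top_degree v f"
  by (simp add: top_degree_def)

lemma top_keys_nonempty: "f \<noteq> 0 \<Longrightarrow> top_keys v f \<noteq> {}"
proof -
  assume "f \<noteq> 0"
  then have "top_degree v f \<in> weight v ` Poly_Mapping.keys f"
    unfolding top_degree_def by (intro Max_in) auto
  then show ?thesis by (auto simp: top_keys_def)
qed

lemma finite_top_keys: "finite (top_keys v f)"
  by (simp add: top_keys_def)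

lemma weight_add: "weight v (a + b) = weight v a + weight v b"
  by (simp add: weight_def lookup_add algebra_simps sum.distrib)

lemma weight_single: "weight v (Poly_Mapping.single i k) = v i * k"
proof -
  have "weight v (Poly_Mapping.single i k) = (\<Sum>j\<in>UNIV. if j = i then v i * k else 0)"
    unfolding weight_def by (intro sum.cong) (auto simp: lookup_single when_def)
  then show ?thesis by simp
qed

text \<open>The normalized limits of \<open>f\<close> and \<open>g\<close> multiply to a limit of
  \<open>f * g\<close>; comparison with the given limit \<open>h\<close>, which is not identically
  zero, fixes the degree. No product of exponent sets has to be expanded.\<close>

lemma top_part_factorization:
  fixes f g :: "'d::finite laurent"
  assumes e: "\<And>j. e j \<noteq> 0" and nz: "f \<noteq> 0" "g \<noteq> 0"
    and lim: "\<And>x. x \<in> torus \<Longrightarrow>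
      (\<lambda>n. laurent_eval (f * g) (\<lambda>j. coord_powi e x j * of_nat (Suc n) powi v j) * of_nat (Suc n) powi (- H))
      \<longlonglongrightarrow> h x"
    and h: "x1 \<in> torus" "h x1 \<noteq> 0"
  shows "top_degree v f + top_degree v g = H"
    and "\<And>x. x \<in> torus \<Longrightarrow> sum_eval (top_keys v f) (Poly_Mapping.lookup f) (coord_powi e x) *
      sum_eval (top_keys v g) (Poly_Mapping.lookup g) (coord_powi e x) = h x"
proof -
  let ?t = "\<lambda>n. complex_of_nat (Suc n)"
  let ?z = "\<lambda>x n j. coord_powi e x j * ?t n powi v j"
  let ?top = "\<lambda>f x. sum_eval (top_keys v f) (Poly_Mapping.lookup f) (coord_powi e x)"
  define D where "D = top_degree v f + top_degree v g"
  have tnz: "?t n \<noteq> 0" for n by (rule of_nat_neq_0)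
  have top_lim: "(\<lambda>n. laurent_eval f (?z x n) * ?t n powi (- top_degree v f)) \<longlonglongrightarrow> ?top f x"
    for f :: "'d laurent" and x
    unfolding laurent_eval_def top_keys_def
    by (rule sum_eval_scaling_limit) (auto intro: weight_le_top_degree)
  have fg_lim: "(\<lambda>n. laurent_eval (f * g) (?z x n) * ?t n powi (- D)) \<longlonglongrightarrow> ?top f x * ?top g x"
    if x: "x \<in> torus" for x
  proof -
    have "laurent_eval (f * g) (?z x n) * ?t n powi (- D) =
        (laurent_eval f (?z x n) * ?t n powi (- top_degree v f)) *
        (laurent_eval g (?z x n) * ?t n powi (- top_degree v g))" for n
    proof -
      have "?z x n \<in> torus" using coord_powi_torus[OF x, of e] tnz[of n] by (simp add: torus_def del: of_nat_Suc)
      from laurent_eval_mult[OF this, of f g]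
        power_int_add[OF disjI1[OF tnz], of n "- top_degree v f" "- top_degree v g"]
      show ?thesis by (simp add: D_def mult_ac del: of_nat_Suc)
    qed
    then show ?thesis using tendsto_mult[OF top_lim top_lim] by presburger
  qed
  have rescale: "laurent_eval (f * g) (?z x n) * ?t n powi (- D) =
      laurent_eval (f * g) (?z x n) * ?t n powi (- H) * ?t n powi (H - D)" for x n
    using power_int_add[OF disjI1[OF tnz], of n "- H" "H - D"] by (simp add: mult.assoc del: of_nat_Suc)
  \<comment> \<open>Too small a sum of degrees would force the limit 0 at \<open>x1\<close>, where
    \<open>h\<close> is nonzero.\<close>
  have "D \<ge> H"
  proof (rule ccontr)
    assume "\<not> D \<ge> H"
    then have "D - H < 0" by simp
    have "laurent_eval (f * g) (?z x1 n) * ?t n powi (- H) =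
        laurent_eval (f * g) (?z x1 n) * ?t n powi (- D) * ?t n powi (D - H)" for n
      using power_int_add[OF disjI1[OF tnz], of n "- D" "D - H"] by (simp add: mult.assoc del: of_nat_Suc)
    moreover have "(\<lambda>n. laurent_eval (f * g) (?z x1 n) * ?t n powi (- D) * ?t n powi (D - H))
        \<longlonglongrightarrow> ?top f x1 * ?top g x1 * 0"
      by (rule tendsto_mult[OF fg_lim[OF h(1)] of_nat_powi_tendsto_0[OF \<open>D - H < 0\<close>]])
    ultimately have "(\<lambda>n. laurent_eval (f * g) (?z x1 n) * ?t n powi (- H)) \<longlonglongrightarrow> 0"
      by (simp only: mult_zero_right)
    with lim[OF h(1)] h(2) show False using LIMSEQ_unique by blast
  qed
  \<comment> \<open>Too large a sum would make the product of the top parts vanish everywhere, but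
    the two nonempty \<open>line_open\<close> sets where they are nonzero meet.\<close>
  moreover have "D \<le> H"
  proof (rule ccontr)
    assume "\<not> D \<le> H"
    then have "H - D < 0" by simp
    have ne: "{y\<in>torus. ?top f y \<noteq> 0} \<noteq> {}" if "f \<noteq> 0" for f :: "'d laurent"
    proof -
      obtain a where "a \<in> top_keys v f" using top_keys_nonempty[OF \<open>f \<noteq> 0\<close>] by blast
      moreover from this have "Poly_Mapping.lookup f a \<noteq> 0" by (simp add: top_keys_def in_keys_iff)
      ultimately show ?thesis
        using sum_eval_nonzero_exists[OF finite_top_keys, of e a v f "Poly_Mapping.lookup f"] e by blast
    qed
    have "{y\<in>torus. ?top f y \<noteq> 0} \<inter> {y\<in>torus. ?top g y \<noteq> 0} \<noteq> {}"
      by (intro line_open_Int_nonempty line_open_sum_eval finite_top_keys ne nz)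
    then obtain x0 where x0: "x0 \<in> torus" "?top f x0 * ?top g x0 \<noteq> 0" by auto
    have "(\<lambda>n. laurent_eval (f * g) (?z x0 n) * ?t n powi (- H) * ?t n powi (H - D)) \<longlonglongrightarrow> h x0 * 0"
      by (rule tendsto_mult[OF lim[OF x0(1)] of_nat_powi_tendsto_0[OF \<open>H - D < 0\<close>]])
    with fg_lim[OF x0(1)] x0(2) show False
      unfolding rescale mult_zero_right using LIMSEQ_unique by blast
  qed
  ultimately have "D = H" by simp
  then show "top_degree v f + top_degree v g = H" by (simp add: D_def)
  show "?top f x * ?top g x = h x" if "x \<in> torus" for x
    using fg_lim[OF that] lim[OF that] LIMSEQ_unique unfolding \<open>D = H\<close> by blast
qed

text \<open>When the sign at one index \<open>i\<close> is flipped, dimension at least 3 leaves two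
  further indices \<open>k\<close> and \<open>l\<close> with sign 1. Their \<open>\<beta>\<close>
  agree, so their \<open>\<alpha>\<close> differ, and the dichotomy must again choose
  \<open>\<beta>\<close>. Thus all \<open>\<beta>\<close> equal one \<open>b\<close>, which is
  maximal for every sign vector; this leaves no other exponent.\<close>

lemma is_monomial_if_vertices_coincide:
  fixes q :: "'d::finite \<Rightarrow> nat" and g :: "'d laurent" and \<alpha> \<beta> :: "'d \<Rightarrow> int \<Rightarrow> ('d \<Rightarrow>\<^sub>0 int)"
  assumes card: "card (UNIV :: 'd set) \<ge> 3" and q: "\<And>j. q j > 0"
    and dich: "\<And>s. (\<And>j. s j \<in> {1, -1}) \<Longrightarrow>
      (\<forall>i k. \<alpha> i (s i) = \<alpha> k (s k)) \<or> (\<forall>i k. \<beta> i (s i) = \<beta> k (s k))"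
    and neq: "\<And>i k \<sigma> \<tau>. i \<noteq> k \<Longrightarrow> \<sigma> \<in> {1, -1} \<Longrightarrow> \<tau> \<in> {1, -1} \<Longrightarrow> \<alpha> i \<sigma> + \<beta> i \<sigma> \<noteq> \<alpha> k \<tau> + \<beta> k \<tau>"
    and max: "\<And>s i a. (\<And>j. s j \<in> {1, -1}) \<Longrightarrow> a \<in> Poly_Mapping.keys g \<Longrightarrow>
      weight (\<lambda>j. s j * int (q j)) a \<le> weight (\<lambda>j. s j * int (q j)) (\<beta> i (s i))"
    and mem: "\<And>i. \<beta> i 1 \<in> Poly_Mapping.keys g"
    and eq: "\<And>i k. \<beta> i 1 = \<beta> k 1"
  shows "is_monomial g"
proof -
  define b where "b = \<beta> undefined 1"
  have b: "\<beta> i 1 = b" for i unfolding b_def by (rule eq)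
  have all: "\<beta> i \<sigma> = b" if \<sigma>: "\<sigma> \<in> {1, -1}" for i \<sigma>
  proof -
    have "\<exists>k l. k \<noteq> i \<and> l \<noteq> i \<and> k \<noteq> l"
    proof -
      have "card (UNIV - {i}) \<ge> 2" using card by (simp add: card_Diff_singleton)
      then obtain T where "T \<subseteq> UNIV - {i}" "card T = 2" by (rule obtain_subset_with_card_n)
      then show ?thesis by (auto simp: card_2_iff)
    qed
    then obtain k l where kl: "k \<noteq> i" "l \<noteq> i" "k \<noteq> l" by blast
    define s where "s = (\<lambda>j. if j = i then \<sigma> else 1)"
    have "\<alpha> k (s k) \<noteq> \<alpha> l (s l)" using neq[OF kl(3), of 1 1] b kl by (simp add: s_def)
    moreover have "s j \<in> {1, -1}" for j using \<sigma> by (simp add: s_def)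
    ultimately have "\<beta> i (s i) = \<beta> k (s k)" using dich[of s] by blast
    then show ?thesis using kl b by (simp add: s_def)
  qed
  have "a = b" if a: "a \<in> Poly_Mapping.keys g" for a
  proof (rule poly_mapping_eqI)
    fix j
    \<comment> \<open>Signs are chosen so that every coordinate contributes a nonnegative term to
      the weight of \<open>a\<close> minus that of \<open>b\<close>; maximality of \<open>b\<close>
      makes all these terms 0.\<close>
    define s where "s j = (if Poly_Mapping.lookup a j \<ge> Poly_Mapping.lookup b j then 1 else -1 :: int)" for j
    have s: "s j \<in> {1, -1}" for j by (simp add: s_def)
    have "weight (\<lambda>j. s j * int (q j)) a \<le> weight (\<lambda>j. s j * int (q j)) b"
      using max[of s a undefined, OF s a] by (simp only: all[OF s])
    then have "(\<Sum>j\<in>UNIV. s j * int (q j) * (Poly_Mapping.lookup a j - Poly_Mapping.lookup b j)) \<le> 0"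
      by (simp add: weight_def right_diff_distrib sum_subtractf)
    moreover have pos: "s j * int (q j) * (Poly_Mapping.lookup a j - Poly_Mapping.lookup b j) \<ge> 0" for j
      by (simp add: s_def mult_nonneg_nonneg mult_nonneg_nonpos)
    ultimately have "(\<Sum>j\<in>UNIV. s j * int (q j) * (Poly_Mapping.lookup a j - Poly_Mapping.lookup b j)) = 0"
      by (simp add: antisym sum_nonneg)
    then have "s j * int (q j) * (Poly_Mapping.lookup a j - Poly_Mapping.lookup b j) = 0"
      using pos by (subst (asm) sum_nonneg_eq_0_iff) auto
    then show "Poly_Mapping.lookup a j = Poly_Mapping.lookup b j" using q[of j] s[of j] by auto
  qed
  moreover have "b \<in> Poly_Mapping.keys g" using mem b by metis
  ultimately have "Poly_Mapping.keys g = {b}" by blast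
  then have "g = Poly_Mapping.single b (Poly_Mapping.lookup g b)" "Poly_Mapping.lookup g b \<noteq> 0"
    by (metis laurent_sum_singles sum.empty finite.emptyI sum.insert empty_iff add_0_right, simp add: in_keys_iff[symmetric])
  then show ?thesis unfolding is_monomial_def by blast
qed

text \<open>The leading part of the Floquet polynomial in direction \<open>w\<close>, written in the
  gauge variables \<open>x\<close> as a product over Fourier modes.\<close>

definition hop_symbol :: "('d::finite \<Rightarrow> nat) \<Rightarrow> ('d \<Rightarrow> int) \<Rightarrow> ('d \<Rightarrow> complex) \<Rightarrow> complex" where
  "hop_symbol q w x = (\<Prod>k\<in>fund_domain q. - (\<Sum>j\<in>{j. w j \<noteq> 0}. unity_root (q j) (w j * k j) * x j powi w j))"

text \<open>Scaling \<open>x j\<close> by \<open>t powi w j\<close> scales \<open>z j\<close> by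
  \<open>t powi (w j * int (q j))\<close>; this puts the limit into the form required by
  \<open>top_part_factorization\<close>.\<close>

lemma floquet_top_limit:
  fixes q :: "'d::finite \<Rightarrow> nat" and w :: "'d \<Rightarrow> int"
  assumes q: "\<And>j. q j > 0" and x: "x \<in> torus" and w: "\<And>j. w j \<in> {-1, 0, 1}"
  shows "(\<lambda>n. laurent_eval (floquet_poly q V lam)
        (\<lambda>j. coord_powi (\<lambda>j. int (q j)) x j * of_nat (Suc n) powi (w j * int (q j)))
      * of_nat (Suc n) powi (- int (card (fund_domain q)))) \<longlonglongrightarrow> hop_symbol q w x"
proof -
  have "coord_powi (\<lambda>j. int (q j)) (\<lambda>j. x j * of_nat (Suc n) powi w j) =
      (\<lambda>j. coord_powi (\<lambda>j. int (q j)) x j * of_nat (Suc n) powi (w j * int (q j)))" for n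
    unfolding coord_powi_def power_int_mult_distrib power_int_mult ..
  then show ?thesis using floquet_scaling_limit[of q x w V lam, OF q x w] unfolding hop_symbol_def by simp
qed

text \<open>For an axis direction each linear form has a single term, so the symbol is a monomial,
  the one belonging to a vertex of the Newton polytope.\<close>

lemma hop_symbol_axis:
  assumes "\<sigma> \<noteq> 0"
  shows "hop_symbol q (\<lambda>j. if j = i then \<sigma> else 0) x =
    (\<Prod>k\<in>fund_domain q. - unity_root (q i) (\<sigma> * k i)) * x i powi (\<sigma> * int (card (fund_domain q)))"
proof -
  have "{j. (if j = i then \<sigma> else 0) \<noteq> 0} = {i}" using assms by auto
  then show ?thesis
    by (simp add: hop_symbol_def prod.distrib power_int_mult flip: mult_minus_left)
qed

lemma hop_symbol_axis_nonzero:
  assumes "\<sigma> \<noteq> 0" "x \<in> torus"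
  shows "hop_symbol q (\<lambda>j. if j = i then \<sigma> else 0) x \<noteq> 0"
  using assms by (simp add: hop_symbol_axis torus_def finite_fund_domain)

lemma ones_torus: "(\<lambda>_. 1) \<in> torus"
  by (simp add: torus_def)

text \<open>The zero polynomial would have scaling limit 0, whereas an axis symbol does not vanish
  on the torus.\<close>

lemma floquet_poly_nonzero:
  fixes q :: "'d::finite \<Rightarrow> nat"
  assumes q: "\<And>j. q j > 0"
  shows "floquet_poly q V lam \<noteq> 0"
proof
  let ?w = "\<lambda>j :: 'd. if j = undefined then 1 else 0 :: int"
  assume "floquet_poly q V lam = 0"
  then have "(\<lambda>n. 0) \<longlonglongrightarrow> hop_symbol q ?w (\<lambda>_. 1)"
    using floquet_top_limit[of q "\<lambda>_. 1" ?w V lam, OF q ones_torus] by simp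
  then have "hop_symbol q ?w (\<lambda>_. 1) = 0" using LIMSEQ_unique tendsto_const by metis
  then show False using hop_symbol_axis_nonzero[of 1 "\<lambda>_. 1" q undefined] ones_torus by simp
qed

text \<open>In the axis direction given by \<open>i\<close> and \<open>\<sigma>\<close> the leading
  part is a nonzero multiple of this very monomial, and linear independence of monomials forces its
  exponent to occur.\<close>

lemma floquet_poly_vertex:
  fixes q :: "'d::finite \<Rightarrow> nat"
  assumes q: "\<And>j. q j > 0" and \<sigma>: "\<sigma> \<in> {1, -1}"
  shows "Poly_Mapping.single i (\<sigma> * int (\<Prod>j\<in>UNIV-{i}. q j)) \<in> Poly_Mapping.keys (floquet_poly q V lam)"
proof (rule ccontr)
  let ?P = "floquet_poly q V lam" and ?e = "\<lambda>j. int (q j)"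
  let ?w = "\<lambda>j. if j = i then \<sigma> else 0" and ?a = "Poly_Mapping.single i (\<sigma> * int (\<Prod>j\<in>UNIV-{i}. q j))"
  let ?v = "\<lambda>j. ?w j * int (q j)"
  define C where "C = (\<Prod>k\<in>fund_domain q. - unity_root (q i) (\<sigma> * k i))"
  assume a: "?a \<notin> Poly_Mapping.keys ?P"
  have C: "C \<noteq> 0" by (simp add: C_def finite_fund_domain)
  have \<sigma>0: "\<sigma> \<noteq> 0" and e: "\<And>j. ?e j \<noteq> 0" using \<sigma> q by auto
  \<comment> \<open>The factor 1 lets \<open>top_part_factorization\<close> apply with a trivial
    second factor.\<close>
  have lim: "(\<lambda>n. laurent_eval (?P * 1)
        (\<lambda>j. coord_powi ?e x j * of_nat (Suc n) powi ?v j) * of_nat (Suc n) powi (- int (card (fund_domain q))))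
      \<longlonglongrightarrow> hop_symbol q ?w x" if "x \<in> torus" for x
    unfolding mult_1_right by (rule floquet_top_limit[OF q that]) (use \<sigma> in auto)
  have top1: "sum_eval (top_keys ?v 1) (Poly_Mapping.lookup 1) y = 1" for y :: "'d \<Rightarrow> complex"
  proof -
    have "Poly_Mapping.keys (1 :: 'd laurent) = {0}" by simp
    then have "top_keys ?v 1 = {0}" by (auto simp: top_keys_def top_degree_def)
    then show ?thesis by (simp add: sum_eval_def lookup_one)
  qed
  have top: "sum_eval (top_keys ?v ?P) (Poly_Mapping.lookup ?P) (coord_powi ?e x) = C * mono_eval ?a (coord_powi ?e x)"
    if x: "x \<in> torus" for x
  proof -
    have "sum_eval (top_keys ?v ?P) (Poly_Mapping.lookup ?P) (coord_powi ?e x) = hop_symbol q ?w x"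
      using top_part_factorization(2)[OF e floquet_poly_nonzero[OF q] one_neq_zero lim ones_torus
          hop_symbol_axis_nonzero[OF \<sigma>0 ones_torus] x] by (simp add: top1)
    also have "\<dots> = C * mono_eval ?a (coord_powi ?e x)"
    proof -
      have "card (fund_domain q) = q i * (\<Prod>j\<in>UNIV-{i}. q j)"
        unfolding card_fund_domain by (rule prod.remove) auto
      then have "\<sigma> * int (card (fund_domain q)) = int (q i) * (\<sigma> * int (\<Prod>j\<in>UNIV-{i}. q j))"
        by simp
      then show ?thesis
        by (simp only: hop_symbol_axis[OF \<sigma>0] C_def mono_eval_single coord_powi_def power_int_mult)
    qed
    finally show ?thesis .
  qed
  have a': "?a \<notin> top_keys ?v ?P" using a by (simp add: top_keys_def)
  \<comment> \<open>If the exponent were missing, moving its monomial to the other side would give a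
    linear relation with the nonzero coefficient \<open>- C\<close>.\<close>
  define c where "c = (Poly_Mapping.lookup ?P)(?a := - C)"
  have "\<forall>u\<in>insert ?a (top_keys ?v ?P). c u = 0"
  proof (rule mono_eval_lin_indep[of _ ?e])
    fix y :: "'d \<Rightarrow> complex" assume y: "y \<in> torus"
    have "sum_eval (top_keys ?v ?P) c (coord_powi ?e y) =
        sum_eval (top_keys ?v ?P) (Poly_Mapping.lookup ?P) (coord_powi ?e y)"
      unfolding sum_eval_def by (intro sum.cong refl) (use a' in \<open>auto simp: c_def\<close>)
    moreover have "sum_eval (insert ?a (top_keys ?v ?P)) c (coord_powi ?e y) =
        c ?a * mono_eval ?a (coord_powi ?e y) + sum_eval (top_keys ?v ?P) c (coord_powi ?e y)"
      unfolding sum_eval_def by (rule sum.insert[OF finite_top_keys a'])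
    moreover have "c ?a = - C" by (simp add: c_def)
    ultimately show "sum_eval (insert ?a (top_keys ?v ?P)) c (coord_powi ?e y) = 0" using top[OF y] by simp
  qed (use e in \<open>auto simp: finite_top_keys\<close>)
  then show False using C by (simp add: c_def)
qed

text \<open>With \<open>x j = y j powi s j\<close> the leading part becomes a product of pairwise
  non-proportional linear forms in \<open>y\<close>, while \<open>z j = y j powi v j\<close>. Hence
  \<open>factor_single_term\<close> applies with exponent vector \<open>v\<close>.\<close>

lemma facet_factor_single_term:
  fixes q :: "'d::finite \<Rightarrow> nat" and f g :: "'d laurent"
  assumes q: "\<And>j. q j > 0" and Gcd: "Gcd (range q) = 1" and s: "\<And>j. s j \<in> {1, -1}"
    and fg: "floquet_poly q V lam = f * g"
  defines "v \<equiv> \<lambda>j. s j * int (q j)"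
  shows "top_degree v f + top_degree v g = int (card (fund_domain q))"
    and "(\<forall>a\<in>top_keys v f. \<forall>a'\<in>top_keys v f. a = a') \<or> (\<forall>b\<in>top_keys v g. \<forall>b'\<in>top_keys v g. b = b')"
proof -
  let ?e = "\<lambda>j. int (q j)"
  define \<omega> where "\<omega> k j = unity_root (q j) (s j * k j)" for k j
  interpret hyperplane_product "fund_domain q" \<omega> v
  proof
    show "fund_domain q \<noteq> {}" using q by (auto simp: fund_domain_def intro!: exI[of _ "\<lambda>_. 0"])
    show "v j \<noteq> 0" for j using q[of j] s[of j] by (auto simp: v_def)
    show "\<omega> k j powi v j = 1" for k j
      using unity_root_eq_1_iff[OF q, of j "s j * k j * v j"] by (simp add: \<omega>_def unity_root_powi v_def)
    show "\<exists>j. \<omega> k j \<noteq> r * \<omega> k' j"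
      if "k \<in> fund_domain q" "k' \<in> fund_domain q" "k \<noteq> k'" for k k' r
      unfolding \<omega>_def by (rule unity_roots_not_proportional[OF q Gcd s that])
  qed (rule finite_fund_domain)
  have e: "?e j \<noteq> 0" for j using q[of j] by simp
  have nz: "f \<noteq> 0" "g \<noteq> 0" using floquet_poly_nonzero[of q V lam, OF q] fg by auto
  \<comment> \<open>The substitution turns \<open>x j powi s j\<close> into \<open>y j\<close>,
    because \<open>s j * s j = 1\<close>.\<close>
  have symbol: "hop_symbol q s (coord_powi s y) = (\<Prod>k\<in>fund_domain q. - form k y)" for y
  proof -
    have "s j * s j = 1" "s j \<noteq> 0" for j using s[of j] by auto
    then show ?thesis
      by (simp add: hop_symbol_def form_def \<omega>_def coord_powi_def flip: power_int_mult)
  qed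
  have lim: "(\<lambda>n. laurent_eval (f * g) (\<lambda>j. coord_powi ?e x j * of_nat (Suc n) powi v j)
      * of_nat (Suc n) powi (- int (card (fund_domain q)))) \<longlonglongrightarrow> hop_symbol q s x" if "x \<in> torus" for x
    unfolding v_def fg[symmetric] by (rule floquet_top_limit[OF q that]) (use s in auto)
  \<comment> \<open>Finitely many nonempty \<open>line_open\<close> sets meet, so some torus point
    avoids all hyperplanes; it supplies the nonvanishing needed to fix the top degree.\<close>
  obtain y where y: "y \<in> torus" "hop_symbol q s y \<noteq> 0"
  proof -
    have "line_open {y. form k y \<noteq> 0}" for k
      unfolding form_def
      by (intro line_open_nonzero poly_on_lines_sum poly_on_lines_mult poly_on_lines_const poly_on_lines_coord)
    moreover have "{y. form k y \<noteq> 0} \<noteq> {}" if "k \<in> fund_domain q" for k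
    proof -
      have "form k (\<lambda>j. if j = undefined then 1 else 0) = \<omega> k undefined"
        by (simp add: form_def if_distrib cong: if_cong)
      then have "(\<lambda>j. if j = undefined then 1 else 0) \<in> {y. form k y \<noteq> 0}"
        using \<omega>_nonzero[OF that] by simp
      then show ?thesis by blast
    qed
    moreover have "line_open {y :: 'd \<Rightarrow> complex. (\<Prod>j\<in>UNIV. y j) \<noteq> 0}"
      by (intro line_open_nonzero poly_on_lines_prod poly_on_lines_coord)
    moreover have "{y :: 'd \<Rightarrow> complex. (\<Prod>j\<in>UNIV. y j) \<noteq> 0} = torus" by (auto simp: torus_def)
    ultimately have "torus \<inter> (\<Inter>k\<in>fund_domain q. {y. form k y \<noteq> 0}) \<noteq> {}"
      using line_open_INT_nonempty[OF finite_fund_domain, of torus q "\<lambda>k. {y. form k y \<noteq> 0}"] ones_torus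
      by auto
    then obtain y where "y \<in> torus" "\<And>k. k \<in> fund_domain q \<Longrightarrow> form k y \<noteq> 0" by auto
    then have "coord_powi s y \<in> torus" "hop_symbol q s (coord_powi s y) \<noteq> 0"
      by (simp_all add: coord_powi_torus symbol finite_fund_domain)
    then show thesis by (rule that)
  qed
  show "top_degree v f + top_degree v g = int (card (fund_domain q))"
    by (rule top_part_factorization(1)[OF e nz lim y])
  have "sum_eval (top_keys v f) (Poly_Mapping.lookup f) (coord_powi v y) *
      sum_eval (top_keys v g) (Poly_Mapping.lookup g) (coord_powi v y) = (\<Prod>k\<in>fund_domain q. - form k y)"
    if "y \<in> torus" for y
  proof -
    have "coord_powi ?e (coord_powi s y) = coord_powi v y"
      unfolding coord_powi_def v_def power_int_mult ..
    then show ?thesis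
      using top_part_factorization(2)[OF e nz lim y coord_powi_torus[OF that], of s] by (simp add: symbol)
  qed
  then show "(\<forall>a\<in>top_keys v f. \<forall>a'\<in>top_keys v f. a = a') \<or> (\<forall>b\<in>top_keys v g. \<forall>b'\<in>top_keys v g. b = b')"
    by (intro factor_single_term finite_top_keys) (auto simp: top_keys_def in_keys_iff)
qed

section \<open>Irreducibility from the facets of the cross-polytope\<close>

theorem mainTheorem4:
  fixes q :: "'d::finite \<Rightarrow> nat" and V :: "('d \<Rightarrow> int) \<Rightarrow> complex" and lam :: complex
  assumes "card (UNIV :: 'd set) \<ge> 3"
    and "\<And>j. q j > 0"
    and "Gcd (q ` UNIV) = 1"
    and "\<And>n j. V (n(j := n j + int (q j))) = V n"
  shows "\<not> (\<exists>f g :: 'd laurent. floquet_poly q V lam = f * g \<and> \<not> is_monomial f \<and> \<not> is_monomial g)"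
proof -
  note q = assms(2) and Gcd = assms(3)
  have "is_monomial f \<or> is_monomial g" if fg: "floquet_poly q V lam = f * g" for f g :: "'d laurent"
  proof -
    define c where "c i = int (\<Prod>j\<in>UNIV-{i}. q j)" for i
    have c: "int (q i) * c i = int (card (fund_domain q))" and c0: "c i \<noteq> 0" for i
    proof -
      have "card (fund_domain q) = q i * (\<Prod>j\<in>UNIV-{i}. q j)"
        unfolding card_fund_domain by (rule prod.remove) auto
      then show "int (q i) * c i = int (card (fund_domain q))" by (simp add: c_def)
      show "c i \<noteq> 0" using q by (simp add: c_def)
    qed
    \<comment> \<open>The sum is prescribed only for signs \<open>\<sigma>\<close>. For any other
      integer an arbitrary pair of exponents serves as default, so that membership in the keys holds
      without a side condition.\<close>
    define R where "R i \<sigma> p \<longleftrightarrow> fst p \<in> Poly_Mapping.keys f \<and> snd p \<in> Poly_Mapping.keys g \<and>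
        (\<sigma> \<in> {1, -1} \<longrightarrow> fst p + snd p = Poly_Mapping.single i (\<sigma> * c i))" for i \<sigma> p
    have "\<exists>p. R i \<sigma> p" for i \<sigma>
    proof -
      \<comment> \<open>Each vertex occurs in the product and is therefore a sum of an exponent of
        \<open>f\<close> and one of \<open>g\<close>.\<close>
      have ex: "\<exists>p. fst p \<in> Poly_Mapping.keys f \<and> snd p \<in> Poly_Mapping.keys g \<and>
          fst p + snd p = Poly_Mapping.single i (\<sigma> * c i)" if "\<sigma> \<in> {1, -1}" for \<sigma>
        using floquet_poly_vertex[of q \<sigma> i V lam, OF q that] keys_mult[of f g] unfolding fg c_def by force
      show ?thesis unfolding R_def using ex[of \<sigma>] ex[of 1] by (cases "\<sigma> \<in> {1, -1}") auto
    qed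
    then have p: "R i \<sigma> (SOME p. R i \<sigma> p)" for i \<sigma> by (rule someI_ex)
    define \<alpha> \<beta> where "\<alpha> i \<sigma> = fst (SOME p. R i \<sigma> p)" and "\<beta> i \<sigma> = snd (SOME p. R i \<sigma> p)" for i \<sigma>
    have \<alpha>: "\<alpha> i \<sigma> \<in> Poly_Mapping.keys f" and \<beta>: "\<beta> i \<sigma> \<in> Poly_Mapping.keys g" for i \<sigma>
      using p[of i \<sigma>] unfolding \<alpha>_def \<beta>_def R_def by blast+
    have sum: "\<alpha> i \<sigma> + \<beta> i \<sigma> = Poly_Mapping.single i (\<sigma> * c i)" if "\<sigma> \<in> {1, -1}" for i \<sigma>
      using p[of i \<sigma>] that unfolding \<alpha>_def \<beta>_def R_def by blast
    have neq: "\<alpha> i \<sigma> + \<beta> i \<sigma> \<noteq> \<alpha> k \<tau> + \<beta> k \<tau>" if "i \<noteq> k" "\<sigma> \<in> {1, -1}" "\<tau> \<in> {1, -1}" for i k \<sigma> \<tau>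
    proof
      assume "\<alpha> i \<sigma> + \<beta> i \<sigma> = \<alpha> k \<tau> + \<beta> k \<tau>"
      then have "Poly_Mapping.lookup (Poly_Mapping.single i (\<sigma> * c i)) i =
          Poly_Mapping.lookup (Poly_Mapping.single k (\<tau> * c k)) i" using sum that by simp
      then show False using that c0[of i] by (auto simp: lookup_single)
    qed
    \<comment> \<open>The weights of the two summands add up to the sum of the top degrees, so both
      are maximal.\<close>
    have top: "\<alpha> i (s i) \<in> top_keys (\<lambda>j. s j * int (q j)) f \<and> \<beta> i (s i) \<in> top_keys (\<lambda>j. s j * int (q j)) g"
      if s: "\<And>j. s j \<in> {1, -1}" for s i
    proof -
      let ?v = "\<lambda>j. s j * int (q j)"
      have "weight ?v (\<alpha> i (s i)) + weight ?v (\<beta> i (s i)) = s i * s i * (int (q i) * c i)"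
        by (simp add: sum[OF s] weight_single flip: weight_add)
      also have "\<dots> = top_degree ?v f + top_degree ?v g"
        using facet_factor_single_term(1)[of q s, OF q Gcd s fg] s[of i] c[of i] by auto
      finally show ?thesis
        using weight_le_top_degree[OF \<alpha>, of ?v i "s i"] weight_le_top_degree[OF \<beta>, of ?v i "s i"] \<alpha> \<beta>
        by (simp add: top_keys_def)
    qed
    have dich: "(\<forall>i k. \<alpha> i (s i) = \<alpha> k (s k)) \<or> (\<forall>i k. \<beta> i (s i) = \<beta> k (s k))"
      if s: "\<And>j. s j \<in> {1, -1}" for s
      using facet_factor_single_term(2)[of q s, OF q Gcd s fg] top[of s, OF s] by blast
    have max: "weight (\<lambda>j. s j * int (q j)) a \<le> weight (\<lambda>j. s j * int (q j)) (\<beta> i (s i))"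
      if "\<And>j. s j \<in> {1, -1}" "a \<in> Poly_Mapping.keys g" for s i a
      using weight_le_top_degree[OF that(2)] top[of s i, OF that(1)] by (simp add: top_keys_def)
    have max': "weight (\<lambda>j. s j * int (q j)) a \<le> weight (\<lambda>j. s j * int (q j)) (\<alpha> i (s i))"
      if "\<And>j. s j \<in> {1, -1}" "a \<in> Poly_Mapping.keys f" for s i a
      using weight_le_top_degree[OF that(2)] top[of s i, OF that(1)] by (simp add: top_keys_def)
    \<comment> \<open>The facet with all signs 1 decides which factor turns out to be the
      monomial.\<close>
    from dich[of "\<lambda>_. 1"] consider "\<forall>i k. \<alpha> i 1 = \<alpha> k 1" | "\<forall>i k. \<beta> i 1 = \<beta> k 1" by auto
    then show ?thesis
    proof cases
      case 1
      have "is_monomial f"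
      \<comment> \<open>The two factors exchange roles here.\<close>
      proof (rule is_monomial_if_vertices_coincide[where q = q and \<alpha> = \<beta> and \<beta> = \<alpha>, OF assms(1) q])
        show "\<beta> i \<sigma> + \<alpha> i \<sigma> \<noteq> \<beta> k \<tau> + \<alpha> k \<tau>" if "i \<noteq> k" "\<sigma> \<in> {1, -1}" "\<tau> \<in> {1, -1}" for i k \<sigma> \<tau>
          using neq[OF that] by (simp add: add.commute)
        show "(\<forall>i k. \<beta> i (s i) = \<beta> k (s k)) \<or> (\<forall>i k. \<alpha> i (s i) = \<alpha> k (s k))"
          if "\<And>j. s j \<in> {1, -1}" for s using dich[of s, OF that] by blast
      qed (use 1 max' \<alpha> in blast)+
      then show ?thesis ..
    next
      case 2
      have "is_monomial g"
        by (rule is_monomial_if_vertices_coincide[where q = q and \<alpha> = \<alpha> and \<beta> = \<beta>, OF assms(1) q dich neq max \<beta>])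
          (use 2 in blast)+
      then show ?thesis ..
    qed
  qed
  then show ?thesis by blast
qed

end
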